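(* Let $\nu>-1$, $\nu\neq0$. Then for every integer $n\ge1$, $$\sum_{k \ge 1} \frac{1}{\Big[\big[(j_n^{\nu})'\big]^2 - \big(j_k^{\nu+1}\big)^2 \Big]^2} = \frac{1}{4\nu^2} - \frac{1}{4\big[(j_n^{\nu})' \big]^2} - \frac{\nu+1}{\big[(j_n^{\nu})'\big]^4}.$$
   Context: For $\mu>-1$, $\{j_n^{\mu}: n\ge1\}$ denotes the sequence of strictly positive zeros, in ascending order, of the Bessel function of the first kind $J_\mu$, and $\{(j_n^{\mu})': n\ge1\}$ denotes the sequence of strictly positive zeros, in ascending order, of the derivative $J_\mu'$; the prime in $(j_n^\mu)'$ is only notation. *)

theory Defs
  imports "HOL-Analysis.Analysis"
begin

(* Power series of the Bessel function of the first kind; only used for x > 0 and \<mu> > -1,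
   where the real power and the Gamma factor have their ordinary meaning. *)
definition bessel_J :: "real \<Rightarrow> real \<Rightarrow> real" where
  "bessel_J \<mu> x =
     (\<Sum>m. (-1) ^ m / (fact m * Gamma (real m + \<mu> + 1)) * (x / 2) powr (2 * real m + \<mu>))"

(* The increasing listing s 1 < s 2 < ... of a set that admits one; its values at
   indices n \<ge> 1 are then uniquely determined, the value at index 0 is irrelevant. *)
definition ascending_seq :: "real set \<Rightarrow> nat \<Rightarrow> real" where
  "ascending_seq Z = (SOME s. strict_mono_on {1..} s \<and> s ` {1..} = Z)"

definition bessel_zero :: "real \<Rightarrow> nat \<Rightarrow> real" where
  "bessel_zero \<mu> = ascending_seq {x. x > 0 \<and> bessel_J \<mu> x = 0}"

definition bessel_deriv_zero :: "real \<Rightarrow> nat \<Rightarrow> real" where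
  "bessel_deriv_zero \<mu> = ascending_seq {x. x > 0 \<and> deriv (bessel_J \<mu>) x = 0}"

end

theory Submission imports Defs
begin

text \<open>
  Put \<open>w = x\<^sup>2 / 4\<close>. Then \<open>J\<^sub>\<mu> x = (x / 2)\<^sup>\<mu> / \<Gamma>(\<mu> + 1) * F\<^sub>\<mu> w\<close> for the entire function
  \<open>F\<^sub>\<mu> w = (\<Sum>m. (-w)\<^sup>m / (m! (\<mu> + 1)\<^sub>m))\<close>, so the positive zeros of \<open>J\<^sub>\<mu>\<close> correspond to those
  of \<open>F\<^sub>\<mu>\<close>, and the sum in question is one sixteenth of the sum of \<open>1 / (w - z)\<^sup>2\<close> over the
  positive zeros \<open>z\<close> of \<open>G = F\<^sub>\<nu>\<^sub>+\<^sub>1\<close>. The core of the proof is the expansion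
  \<open>(\<Sum>z. 1 / (w - z)\<^sup>2) = (G'/G)\<^sup>2 - G''/G\<close>, that is, the derivative of \<open>- G'/G\<close> has the shape it
  would have for a polynomial with only positive roots (lemma \<open>bessel_entire_sum_over_zeros\<close>).

  It is obtained without the Hadamard product theorem. The function \<open>F\<^sub>\<mu>\<close> is the limit of the
  rescaled Laguerre polynomials \<open>L\<^sub>n(w / n)\<close>, normalised at 0, uniformly on bounded intervals and
  together with the first two derivatives. By Rolle's theorem these polynomials have \<open>n\<close> distinct
  positive roots (\<open>laguerre_roots_listed\<close>), so for them the expansion is a finite identity.
  In the limit the roots in a bounded interval converge to the zeros of \<open>F\<^sub>\<mu>\<close>
  (\<open>sum_over_zeros_tendsto\<close>), and the roots beyond \<open>M\<close> contribute only \<open>O(1 / M)\<close>, because the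
  reciprocals of all roots have sum at most \<open>1 / (\<mu> + 1)\<close>. Everything takes place on the real line.

  The remaining ingredients come from the differential equation
  \<open>w F'' + (\<mu> + 1) F' + F = 0\<close>. It forces zeros to be simple (an energy estimate,
  \<open>bessel_entire_zero_simple\<close>) and, combined with the expansion, infinite in number
  (\<open>bessel_entire_infinite_zeros\<close>). A positive zero of \<open>J\<^sub>\<nu>'\<close> corresponds to a solution \<open>w\<close> of
  \<open>\<nu> F\<^sub>\<nu> + 2 w F\<^sub>\<nu>' = 0\<close>; there the ratios \<open>G'/G\<close> and \<open>G''/G\<close> are explicit rational functions of \<open>w\<close>
  and \<open>\<nu>\<close>, which yields the closed form (\<open>bessel_sum_at_critical\<close>). Since the sum is nonnegative,
  the closed form also shows that such a zero exceeds \<open>\<bar>\<nu>\<bar>\<close>; hence it is isolated, and the zeros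
  of \<open>J\<^sub>\<nu>'\<close> do form an ascending sequence.
\<close>

section \<open>Enumeration of locally finite sets\<close>

lemma ascending_seq:
  fixes Z :: "real set"
  assumes "infinite Z" and fin: "\<And>M. finite (Z \<inter> {..M})"
  shows "strict_mono_on {1..} (ascending_seq Z)" and "ascending_seq Z ` {1..} = Z"
proof -
  have least: "\<exists>m\<in>S. \<forall>y\<in>S. m \<le> y" if S: "S \<subseteq> Z" "S \<noteq> {}" for S
  proof -
    obtain y where y: "y \<in> S" using S by blast
    have f: "finite (S \<inter> {..y})" by (rule finite_subset[OF _ fin[of y]]) (use S in auto)
    have m: "Min (S \<inter> {..y}) \<in> S \<inter> {..y}" using y by (intro Min_in f) auto
    have "Min (S \<inter> {..y}) \<le> t" if "t \<in> S" for t
      using m Min_le[OF f, of t] that by (cases "t \<le> y") auto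
    thus ?thesis using m by blast
  qed
  have "\<exists>m\<in>Z. x < m \<and> (\<forall>y\<in>Z. x < y \<longrightarrow> m \<le> y)" for x
  proof -
    have "infinite (Z - Z \<inter> {..x})" using assms(1) fin[of x] by simp
    hence "Z \<inter> {x<..} \<noteq> {}" by (metis Diff_Int Diff_cancel Compl_atMost Diff_eq Un_empty_left finite.emptyI)
    thus ?thesis using least[of "Z \<inter> {x<..}"] by blast
  qed
  then obtain nxt where nxt: "\<And>x. nxt x \<in> Z" "\<And>x. x < nxt x" "\<And>x y. y \<in> Z \<Longrightarrow> x < y \<Longrightarrow> nxt x \<le> y"
    by metis
  have "Z \<noteq> {}" using assms(1) by auto
  then obtain m where m: "m \<in> Z" "\<And>y. y \<in> Z \<Longrightarrow> m \<le> y" using least[of Z] by auto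
  define s where "s n = (nxt ^^ n) m" for n
  have s_Suc: "s (Suc n) = nxt (s n)" and s0: "s 0 = m" for n by (simp_all add: s_def)
  have mono: "strict_mono s" by (simp add: strict_mono_Suc_iff s_Suc nxt)
  have sZ: "s n \<in> Z" for n by (cases n) (auto simp: s0 s_Suc m nxt)
  have surj: "z \<in> range s" if z: "z \<in> Z" for z
  proof (rule ccontr)
    assume nz: "z \<notin> range s"
    have "s n < z" for n
    proof (induction n)
      case 0
      have "s 0 \<noteq> z" using nz by blast
      moreover have "s 0 \<le> z" using m(2)[OF z] by (simp add: s0)
      ultimately show ?case by simp
    next
      case (Suc n)
      have "s (Suc n) \<noteq> z" using nz by blast
      moreover have "s (Suc n) \<le> z" using nxt(3)[OF z Suc] by (simp add: s_Suc)
      ultimately show ?case by simp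
    qed
    hence "range s \<subseteq> Z \<inter> {..z}" using sZ by (auto intro: less_imp_le)
    hence "finite (range s)" using fin finite_subset by blast
    thus False using range_inj_infinite[OF strict_mono_imp_inj_on[OF mono]] by blast
  qed
  have "strict_mono_on {1..} (\<lambda>k. s (k - 1)) \<and> (\<lambda>k. s (k - 1)) ` {1..} = Z"
  proof
    show "strict_mono_on {1..} (\<lambda>k. s (k - 1))"
      by (rule strict_mono_onI) (use strict_monoD[OF mono] in auto)
    show "(\<lambda>k. s (k - 1)) ` {1..} = Z"
    proof
      show "(\<lambda>k. s (k - 1)) ` {1..} \<subseteq> Z" using sZ by auto
      show "Z \<subseteq> (\<lambda>k. s (k - 1)) ` {1..}"
      proof
        fix z assume "z \<in> Z"
        then obtain n where "z = s n" using surj by blast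
        thus "z \<in> (\<lambda>k. s (k - 1)) ` {1..}" by (intro image_eqI[of _ _ "Suc n"]) auto
      qed
    qed
  qed
  hence "strict_mono_on {1..} (ascending_seq Z) \<and> ascending_seq Z ` {1..} = Z"
    unfolding ascending_seq_def by (rule someI[of "\<lambda>s. strict_mono_on {1..} s \<and> s ` {1..} = Z"])
  thus "strict_mono_on {1..} (ascending_seq Z)" "ascending_seq Z ` {1..} = Z" by auto
qed

section \<open>Polynomials with prescribed real roots\<close>

lemma poly_pderiv_linear_mult:
  fixes q :: "real poly"
  shows "poly (pderiv ([:- a, 1:] * q)) x = poly q x + (x - a) * poly (pderiv q) x"
    and "poly (pderiv (pderiv ([:- a, 1:] * q))) x
           = 2 * poly (pderiv q) x + (x - a) * poly (pderiv (pderiv q)) x"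
proof -
  have 1: "pderiv ([:- a, 1:] * q) = q + [:- a, 1:] * pderiv q" for q :: "real poly"
    by (subst pderiv_mult) (simp add: pderiv_pCons)
  show "poly (pderiv ([:- a, 1:] * q)) x = poly q x + (x - a) * poly (pderiv q) x"
    unfolding 1 by (simp add: algebra_simps)
  show "poly (pderiv (pderiv ([:- a, 1:] * q))) x
           = 2 * poly (pderiv q) x + (x - a) * poly (pderiv (pderiv q)) x"
    unfolding 1 pderiv_add by (simp add: algebra_simps)
qed

text \<open>
  Multiplied out, this is \<open>- (p'/p)' = (\<Sum>a\<in>A. 1 / (x - a)\<^sup>2)\<close>, the derivative of the partial
  fraction expansion of \<open>p'/p\<close>.
\<close>
lemma log_deriv_derivative_prod:
  fixes A :: "real set" and x :: real
  assumes "finite A" and "x \<notin> A"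
  defines "p \<equiv> (\<Prod>a\<in>A. [:- a, 1:])"
  shows "(poly (pderiv p) x)\<^sup>2 - poly p x * poly (pderiv (pderiv p)) x
           = (poly p x)\<^sup>2 * (\<Sum>a\<in>A. 1 / (x - a)\<^sup>2)"
  using assms(1,2) unfolding p_def
proof (induction A rule: finite_induct)
  case (insert a A)
  let ?q = "\<Prod>a\<in>A. [:- a, 1:]"
  let ?r = "poly ?q x" and ?r1 = "poly (pderiv ?q) x" and ?r2 = "poly (pderiv (pderiv ?q)) x"
  have IH: "?r1\<^sup>2 - ?r * ?r2 = ?r\<^sup>2 * (\<Sum>a\<in>A. 1 / (x - a)\<^sup>2)" using insert by simp
  have p: "poly (\<Prod>a\<in>insert a A. [:- a, 1:]) x = (x - a) * ?r"
    and p1: "poly (pderiv (\<Prod>a\<in>insert a A. [:- a, 1:])) x = ?r + (x - a) * ?r1"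
    and p2: "poly (pderiv (pderiv (\<Prod>a\<in>insert a A. [:- a, 1:]))) x = 2 * ?r1 + (x - a) * ?r2"
    unfolding prod.insert[OF insert(1,2)] poly_pderiv_linear_mult
    by (simp_all add: algebra_simps)
  have "(?r + (x - a) * ?r1)\<^sup>2 - (x - a) * ?r * (2 * ?r1 + (x - a) * ?r2)
      = ?r\<^sup>2 + (x - a)\<^sup>2 * (?r1\<^sup>2 - ?r * ?r2)"
    by algebra
  also have "\<dots> = ((x - a) * ?r)\<^sup>2 * (1 / (x - a)\<^sup>2 + (\<Sum>a\<in>A. 1 / (x - a)\<^sup>2))"
  proof -
    have "d \<noteq> 0 \<Longrightarrow> r + d * (r * S) = d * r * (1 / d + S)" for d r S :: real
      by (simp add: distrib_left)
    moreover have "(x - a)\<^sup>2 \<noteq> 0" using insert by simp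
    ultimately show ?thesis unfolding IH power_mult_distrib by blast
  qed
  finally show ?case unfolding p p1 p2 sum.insert[OF insert(1,2)] .
qed (simp add: pderiv_1)

lemma log_deriv_at_0_prod:
  fixes A :: "real set"
  assumes "finite A" and "0 \<notin> A"
  defines "p \<equiv> (\<Prod>a\<in>A. [:- a, 1:])"
  shows "poly (pderiv p) 0 = - poly p 0 * (\<Sum>a\<in>A. 1 / a)"
  using assms(1,2) unfolding p_def
proof (induction A rule: finite_induct)
  case (insert a A)
  thus ?case unfolding prod.insert[OF insert(1,2)] sum.insert[OF insert(1,2)] poly_pderiv_linear_mult
    by (simp add: field_simps)
qed (simp add: pderiv_1)

lemma prod_linear_factors_dvd:
  fixes p :: "real poly"
  assumes "finite A" and "\<And>a. a \<in> A \<Longrightarrow> poly p a = 0"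
  shows "(\<Prod>a\<in>A. [:- a, 1:]) dvd p"
  using assms
proof (induction A rule: finite_induct)
  case (insert a A)
  then obtain r where r: "p = (\<Prod>a\<in>A. [:- a, 1:]) * r" by (auto elim: dvdE)
  have "poly (\<Prod>a\<in>A. [:- a, 1:]) a \<noteq> 0" using insert by (auto simp: poly_prod)
  with insert.prems[of a] have "poly r a = 0" by (simp add: r)
  then obtain s where "r = [:- a, 1:] * s" by (auto simp: poly_eq_0_iff_dvd elim: dvdE)
  hence "p = (\<Prod>a\<in>insert a A. [:- a, 1:]) * s"
    unfolding r prod.insert[OF insert(1,2)] by (simp only: mult_ac)
  thus ?case by (rule dvdI)
qed simp

lemma split_by_roots:
  fixes p :: "real poly"
  assumes "finite A" "card A = degree p" "p \<noteq> 0" and "\<And>a. a \<in> A \<Longrightarrow> poly p a = 0"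
  obtains c where "c \<noteq> 0" "p = smult c (\<Prod>a\<in>A. [:- a, 1:])"
proof -
  obtain r where r: "p = (\<Prod>a\<in>A. [:- a, 1:]) * r" using prod_linear_factors_dvd[of A p] assms by (auto elim: dvdE)
  have "degree (\<Prod>a\<in>A. [:- a, 1:]) = card A" by (simp add: degree_prod_sum_eq)
  moreover have "r \<noteq> 0" "(\<Prod>a\<in>A. [:- a, 1:]) \<noteq> 0" using r assms by auto
  ultimately have "degree r = 0" using assms(2) r by (simp add: degree_mult_eq)
  then obtain c where "r = [:c:]" by (elim degree_eq_zeroE)
  with r \<open>r \<noteq> 0\<close> show ?thesis by (intro that[of c]) auto
qed

section \<open>Zeros of limits of real-rooted polynomials\<close>

text \<open>
  Tannery's theorem makes the distance between \<open>P n\<close> and the limit small in the norm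
  \<open>\<Sum>m. \<bar>coefficient\<bar> * R\<^sup>m\<close>, which controls the values on the whole interval at once.
\<close>
lemma uniform_limit_poly_dominated:
  fixes P :: "nat \<Rightarrow> real poly" and g c :: "nat \<Rightarrow> real"
  assumes dom: "\<And>n m. \<bar>coeff (P n) m\<bar> \<le> g m"
    and lim: "\<And>m. (\<lambda>n. coeff (P n) m) \<longlonglongrightarrow> c m"
    and summ: "\<And>r. summable (\<lambda>m. g m * r ^ m)"
  shows "uniform_limit {0..R} (\<lambda>n. poly (P n)) (\<lambda>w. \<Sum>m. c m * w ^ m) sequentially"
proof -
  have c_le: "\<bar>c m\<bar> \<le> g m" for m
    by (rule tendsto_upperbound[OF tendsto_rabs[OF lim]]) (auto simp: dom)
  have g0: "g m \<ge> 0" for m using c_le[of m] by linarith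
  define r where "r = \<bar>R\<bar>"
  have r0: "r \<ge> 0" by (simp add: r_def)
  have sg: "summable (\<lambda>m. g m * r ^ m)" by (rule summ)
  define e where "e n = (\<Sum>m. \<bar>coeff (P n) m - c m\<bar> * r ^ m)" for n
  have dif_le: "\<bar>coeff (P n) m - c m\<bar> * r ^ m \<le> 2 * (g m * r ^ m)" for n m
  proof -
    have "\<bar>coeff (P n) m - c m\<bar> \<le> 2 * g m" using dom[of n m] c_le[of m] by linarith
    hence "\<bar>coeff (P n) m - c m\<bar> * r ^ m \<le> (2 * g m) * r ^ m"
      by (rule mult_right_mono) (use r0 in simp)
    thus ?thesis by simp
  qed
  have dif_sum: "summable (\<lambda>m. \<bar>coeff (P n) m - c m\<bar> * r ^ m)" for n
    by (rule summable_comparison_test'[OF summable_mult[OF sg, of 2], of 0])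
       (use dif_le r0 in \<open>simp add: abs_mult\<close>)
  have "((\<lambda>n. \<Sum>m. \<bar>coeff (P n) m - c m\<bar> * r ^ m) \<longlongrightarrow> (\<Sum>m. 0)) sequentially"
  proof (rule tannerys_theorem[THEN conjunct2, THEN conjunct2])
    show "((\<lambda>n. \<bar>coeff (P n) m - c m\<bar> * r ^ m) \<longlongrightarrow> 0) sequentially" for m
      using tendsto_mult_left_zero[OF tendsto_rabs_zero[OF LIM_zero[OF lim[of m]]]] by simp
    show "\<forall>\<^sub>F (m, n) in at_top \<times>\<^sub>F sequentially.
         norm (\<bar>coeff (P n) m - c m\<bar> * r ^ m) \<le> 2 * (g m * r ^ m)"
      using dif_le r0 by (intro always_eventually) (auto simp: abs_mult)
  qed (use summable_mult[OF sg, of 2] in auto)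
  hence e0: "e \<longlonglongrightarrow> 0" by (simp add: e_def[abs_def])
  have bound: "\<bar>poly (P n) w - (\<Sum>m. c m * w ^ m)\<bar> \<le> e n" if "w \<in> {0..R}" for n w
  proof -
    have w: "\<bar>w\<bar> \<le> r" "w \<ge> 0" using that by (auto simp: r_def)
    have pw: "\<bar>w ^ m\<bar> \<le> r ^ m" for m using w by (simp add: power_mono)
    have sc: "summable (\<lambda>m. c m * w ^ m)"
      by (rule summable_comparison_test'[OF sg, of 0])
         (use c_le g0 pw in \<open>simp add: abs_mult mult_mono\<close>)
    have sP: "(\<lambda>m. coeff (P n) m * w ^ m) sums poly (P n) w"
      unfolding poly_altdef by (rule sums_finite) (auto simp: coeff_eq_0)
    have eq: "poly (P n) w - (\<Sum>m. c m * w ^ m) = (\<Sum>m. (coeff (P n) m - c m) * w ^ m)"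
      using sums_diff[OF sP summable_sums[OF sc]] by (simp add: sums_iff algebra_simps)
    have tl: "norm ((coeff (P n) m - c m) * w ^ m) \<le> \<bar>coeff (P n) m - c m\<bar> * r ^ m" for m
      using pw[of m] by (auto simp: abs_mult intro!: mult_left_mono)
    show ?thesis unfolding eq e_def
      using norm_suminf_le[OF tl dif_sum] by simp
  qed
  show ?thesis
  proof (rule uniform_limitI)
    fix \<epsilon> :: real assume "\<epsilon> > 0"
    hence "\<forall>\<^sub>F n in sequentially. e n < \<epsilon>" using e0 by (rule order_tendstoD(2)[rotated])
    thus "\<forall>\<^sub>F n in sequentially. \<forall>w\<in>{0..R}. dist (poly (P n) w) (\<Sum>m. c m * w ^ m) < \<epsilon>"
    proof eventually_elim
      case (elim n)
      thus ?case using le_less_trans[OF bound] by (simp add: dist_real_def)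
    qed
  qed
qed

text \<open>
  A simple zero is isolated, and a compact interval has no room for infinitely many isolated zeros.
\<close>
lemma simple_zeros_finite:
  fixes F F1 :: "real \<Rightarrow> real"
  assumes dF: "\<And>x. x \<in> {a..b} \<Longrightarrow> (F has_real_derivative F1 x) (at x)"
    and simple: "\<And>x. x \<in> {a..b} \<Longrightarrow> F x = 0 \<Longrightarrow> F1 x \<noteq> 0"
  shows "finite {x \<in> {a..b}. F x = 0}"
proof -
  have "finite ({a..b} \<inter> {x. F x = 0})"
  proof (rule finite_not_islimpt_in_compact)
    fix z assume z: "z \<in> {a..b}"
    show "\<not> z islimpt {x. F x = 0}"
    proof (cases "F z = 0")
      case True
      have "((\<lambda>x. (F x - F z) / (x - z)) \<longlongrightarrow> F1 z) (at z)"
        using dF[OF z] by (simp add: has_field_derivative_iff)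
      hence "eventually (\<lambda>x. (F x - F z) / (x - z) \<noteq> 0) (at z)"
        by (rule tendsto_imp_eventually_ne) (use simple[OF z True] in auto)
      hence "eventually (\<lambda>x. \<not> F x = 0) (at z)"
        by eventually_elim (use True in auto)
      thus ?thesis by (simp add: islimpt_conv_frequently_at frequently_def)
    next
      case False
      have "isCont F z" using dF[OF z] by (rule DERIV_isCont)
      hence "(F \<longlongrightarrow> F z) (at z)" by (simp add: isCont_def)
      hence "eventually (\<lambda>x. F x \<noteq> 0) (at z)"
        by (rule tendsto_imp_eventually_ne) (use False in auto)
      thus ?thesis by (simp add: islimpt_conv_frequently_at frequently_def)
    qed
  qed simp
  thus ?thesis by (simp add: Int_def)
qed

lemma uniform_limit_eventually_nonzero:
  fixes F :: "real \<Rightarrow> real"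
  assumes "uniform_limit S p F sequentially" "compact K" "K \<subseteq> S" "continuous_on K F"
    and "\<And>x. x \<in> K \<Longrightarrow> F x \<noteq> 0"
  shows "eventually (\<lambda>n. \<forall>x\<in>K. p n x \<noteq> 0) sequentially"
proof (cases "K = {}")
  case False
  obtain y where y: "y \<in> K" "\<And>x. x \<in> K \<Longrightarrow> \<bar>F y\<bar> \<le> \<bar>F x\<bar>"
    using continuous_attains_inf[OF assms(2) False, of "\<lambda>x. \<bar>F x\<bar>"] assms(4)
    by (auto intro: continuous_intros)
  have "eventually (\<lambda>n. \<forall>x\<in>S. dist (p n x) (F x) < \<bar>F y\<bar>) sequentially"
    using assms(1) by (rule uniform_limitD) (use assms(5) y in auto)
  thus ?thesis
  proof eventually_elim
    case (elim n)
    show ?case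
    proof
      fix x assume x: "x \<in> K"
      hence "\<bar>p n x - F x\<bar> < \<bar>F x\<bar>"
        using elim y(2)[OF x] assms(3) by (force simp: dist_real_def)
      thus "p n x \<noteq> 0" by auto
    qed
  qed
qed simp

text \<open>
  A real form of Hurwitz's theorem: near a simple zero of \<open>F\<close> there is eventually a zero of \<open>p n\<close>
  by the intermediate value theorem, only one by Rolle's theorem because \<open>p1 n\<close> has no zero there,
  and away from the zeros of \<open>F\<close> there are none by uniform convergence. The zeros in the interval
  thus correspond one to one, and sums over them converge. The hypotheses at the end points
  prevent zeros from crossing the boundary.
\<close>
lemma sum_over_zeros_tendsto:
  fixes F F1 :: "real \<Rightarrow> real" and p p1 :: "nat \<Rightarrow> real \<Rightarrow> real" and g :: "real \<Rightarrow> real"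
  assumes u0: "uniform_limit {0..M} p F sequentially"
    and u1: "uniform_limit {0..M} p1 F1 sequentially"
    and dF: "\<And>x. (F has_real_derivative F1 x) (at x)"
    and cF1: "\<And>x. isCont F1 x"
    and dp: "\<And>n x. (p n has_real_derivative p1 n x) (at x)"
    and F0: "F 0 \<noteq> 0" and FM: "F M \<noteq> 0"
    and simple: "\<And>x. x \<in> {0..M} \<Longrightarrow> F x = 0 \<Longrightarrow> F1 x \<noteq> 0"
  defines "Z \<equiv> {x \<in> {0..M}. F x = 0}"
  assumes g: "\<And>z. z \<in> Z \<Longrightarrow> isCont g z"
  shows "(\<lambda>n. \<Sum>a | a \<in> {0..M} \<and> p n a = 0. g a) \<longlonglongrightarrow> (\<Sum>z\<in>Z. g z)"
proof -
  have finZ: "finite Z" unfolding Z_def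
    by (rule simple_zeros_finite[of _ _ F F1]) (use dF simple in auto)
  have cF: "isCont F x" for x using dF by (rule DERIV_isCont)
  have Zin: "0 < z" "z < M" "F z = 0" "F1 z \<noteq> 0" if "z \<in> Z" for z
    using that F0 FM simple[of z] by (auto simp: Z_def order_le_less)
  \<comment> \<open>Distance within which the zero \<open>z\<close> is the only one: \<open>F1\<close> keeps its sign there.\<close>
  define good where "good z \<epsilon> \<longleftrightarrow> (\<forall>x\<in>{z-\<epsilon>..z+\<epsilon>}. 0 < x \<and> x < M \<and> 0 < F1 x * F1 z)"
    for z \<epsilon> :: real
  have ev_good: "eventually (good z) (at_right 0)" if z: "z \<in> Z" for z
  proof -
    have "eventually (\<lambda>x. 0 < x \<and> x < M \<and> 0 < F1 x * F1 z) (nhds z)"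
    proof (intro eventually_conj)
      have "((\<lambda>x. F1 x * F1 z) \<longlongrightarrow> F1 z * F1 z) (nhds z)"
        using cF1[of z] by (intro tendsto_intros) (simp add: isCont_def tendsto_at_iff_tendsto_nhds)
      thus "eventually (\<lambda>x. 0 < F1 x * F1 z) (nhds z)"
        by (rule order_tendstoD) (use Zin[OF z] in \<open>auto simp: zero_less_mult_iff\<close>)
    qed (use Zin[OF z] in \<open>auto intro!: eventually_nhds_in_open[of "{0<..}", simplified] eventually_nhds_in_open[of "{..<M}", simplified]\<close>)
    then obtain d where d: "d > 0" "\<And>x. dist x z < d \<Longrightarrow> 0 < x \<and> x < M \<and> 0 < F1 x * F1 z"
      by (auto simp: eventually_nhds_metric)
    show ?thesis
      by (rule eventually_at_rightI[of 0 d])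
         (use d in \<open>auto simp: good_def dist_real_def\<close>)
  qed
  have "eventually (\<lambda>\<epsilon>. (\<forall>z\<in>Z. good z \<epsilon>) \<and> (\<forall>z\<in>Z. \<forall>z'\<in>Z. z \<noteq> z' \<longrightarrow> 2 * \<epsilon> < \<bar>z - z'\<bar>) \<and> \<epsilon> > 0) (at_right (0::real))"
  proof (intro eventually_conj eventually_ball_finite finZ ballI)
    fix z z' assume "z \<in> Z" "z' \<in> Z"
    show "eventually (\<lambda>\<epsilon>. z \<noteq> z' \<longrightarrow> 2 * \<epsilon> < \<bar>z - z'\<bar>) (at_right 0)"
      by (cases "z = z'") (auto intro!: eventually_at_rightI[of 0 "\<bar>z - z'\<bar> / 2"])
  qed (use ev_good in \<open>auto intro!: eventually_at_rightI[of 0 1]\<close>)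
  then obtain \<epsilon> where good: "\<And>z. z \<in> Z \<Longrightarrow> good z \<epsilon>"
    and sep: "\<And>z z'. z \<in> Z \<Longrightarrow> z' \<in> Z \<Longrightarrow> z \<noteq> z' \<Longrightarrow> 2 * \<epsilon> < \<bar>z - z'\<bar>" and \<epsilon>: "\<epsilon> > 0"
    by (auto dest!: eventually_happens simp: trivial_limit_at_right_real)
  define B where "B z = {z-\<epsilon><..<z+\<epsilon>}" for z
  have Bin: "B z \<subseteq> {0..M}" if "z \<in> Z" for z
  proof
    fix x assume "x \<in> B z"
    hence "x \<in> {z-\<epsilon>..z+\<epsilon>}" by (simp add: B_def)
    hence "0 < x \<and> x < M" using good[OF that] unfolding good_def by blast
    thus "x \<in> {0..M}" by simp
  qed

  have exists_zero: "eventually (\<lambda>n. \<exists>a. \<bar>a - z\<bar> < \<eta> \<and> p n a = 0) sequentially"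
    if z: "z \<in> Z" and \<eta>: "0 < \<eta>" "\<eta> \<le> \<epsilon>" for z \<eta>
  proof -
    have sgn: "0 < F1 x * F1 z" "0 \<le> x" "x \<le> M" if "z - \<eta> \<le> x" "x \<le> z + \<eta>" for x
    proof -
      have "x \<in> {z-\<epsilon>..z+\<epsilon>}" using that \<eta> by simp
      hence "0 < x \<and> x < M \<and> 0 < F1 x * F1 z" using good[OF z] unfolding good_def by blast
      thus "0 < F1 x * F1 z" "0 \<le> x" "x \<le> M" by simp_all
    qed
    have \<open>0 < F (z + \<eta> / 2) * F1 z\<close>
    proof -
      obtain t where "z < t" "t < z + \<eta> / 2" "F (z + \<eta> / 2) - F z = (z + \<eta> / 2 - z) * F1 t"
        using MVT2[of z "z + \<eta> / 2" F F1] dF \<eta> by auto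
      hence eq: "F (z + \<eta> / 2) * F1 z = (\<eta> / 2) * (F1 t * F1 z)" using Zin[OF z] by simp
      have "0 < F1 t * F1 z" using \<open>z < t\<close> \<open>t < z + \<eta> / 2\<close> \<eta> by (intro sgn) auto
      thus ?thesis unfolding eq using \<eta> mult_pos_pos[of "\<eta> / 2"] by simp
    qed
    moreover have \<open>F (z - \<eta> / 2) * F1 z < 0\<close>
    proof -
      obtain t where "z - \<eta> / 2 < t" "t < z" "F z - F (z - \<eta> / 2) = (z - (z - \<eta> / 2)) * F1 t"
        using MVT2[of "z - \<eta> / 2" z F F1] dF \<eta> by auto
      hence "F (z - \<eta> / 2) = - (\<eta> / 2) * F1 t" using Zin[OF z] by simp
      hence eq: "F (z - \<eta> / 2) * F1 z = - (\<eta> / 2) * (F1 t * F1 z)" by (simp only: mult.assoc)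
      have "0 < F1 t * F1 z" using \<open>z - \<eta> / 2 < t\<close> \<open>t < z\<close> \<eta> by (intro sgn) auto
      thus ?thesis unfolding eq using \<eta> mult_neg_pos[of "- (\<eta> / 2)"] by simp
    qed
    moreover have "(\<lambda>n. p n x * F1 z) \<longlonglongrightarrow> F x * F1 z" if "z - \<eta> \<le> x" "x \<le> z + \<eta>" for x
      using tendsto_uniform_limitI[OF u0, of x] sgn[OF that] by (intro tendsto_intros) auto
    ultimately have "eventually (\<lambda>n. 0 < p n (z + \<eta> / 2) * F1 z) sequentially"
      "eventually (\<lambda>n. p n (z - \<eta> / 2) * F1 z < 0) sequentially"
      using \<eta> by (auto intro!: order_tendstoD)
    thus ?thesis
    proof eventually_elim
      case (elim n)
      have "\<exists>a\<ge>z - \<eta> / 2. a \<le> z + \<eta> / 2 \<and> p n a * F1 z = 0"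
        by (rule IVT) (use elim \<eta> dp[of n] in \<open>auto intro!: continuous_intros intro: DERIV_isCont\<close>)
      then obtain a where "z - \<eta> / 2 \<le> a" "a \<le> z + \<eta> / 2" "p n a * F1 z = 0" by blast
      thus ?case using Zin[OF z] \<eta> by (intro exI[of _ a]) auto
    qed
  qed

  define E where "E n \<longleftrightarrow> (\<forall>z\<in>Z. \<forall>x\<in>{z-\<epsilon>..z+\<epsilon>}. p1 n x \<noteq> 0) \<and>
      (\<forall>x\<in>{0..M} - (\<Union>z\<in>Z. B z). p n x \<noteq> 0) \<and> (\<forall>z\<in>Z. \<exists>a. \<bar>a - z\<bar> < \<epsilon> \<and> p n a = 0)" for n
  have evE: "eventually E sequentially"
  proof -
    have "eventually (\<lambda>n. \<forall>x\<in>{z-\<epsilon>..z+\<epsilon>}. p1 n x \<noteq> 0) sequentially" if z: "z \<in> Z" for z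
    proof (rule uniform_limit_eventually_nonzero[OF u1])
      show "continuous_on {z-\<epsilon>..z+\<epsilon>} F1" using cF1 by (simp add: continuous_at_imp_continuous_on)
      show "{z-\<epsilon>..z+\<epsilon>} \<subseteq> {0..M}"
        using good[OF z] unfolding good_def by (meson atLeastAtMost_iff less_imp_le subsetI)
      fix x assume "x \<in> {z-\<epsilon>..z+\<epsilon>}"
      hence "0 < F1 x * F1 z" using good[OF z] unfolding good_def by blast
      thus "F1 x \<noteq> 0" by auto
    qed simp
    hence "eventually (\<lambda>n. \<forall>z\<in>Z. \<forall>x\<in>{z-\<epsilon>..z+\<epsilon>}. p1 n x \<noteq> 0) sequentially"
      by (rule eventually_ball_finite[OF finZ ballI])
    moreover have "eventually (\<lambda>n. \<forall>z\<in>Z. \<exists>a. \<bar>a - z\<bar> < \<epsilon> \<and> p n a = 0) sequentially"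
      by (rule eventually_ball_finite[OF finZ ballI]) (use exists_zero[OF _ \<epsilon>] in simp)
    moreover have "eventually (\<lambda>n. \<forall>x\<in>{0..M} - (\<Union>z\<in>Z. B z). p n x \<noteq> 0) sequentially"
    proof (rule uniform_limit_eventually_nonzero[OF u0])
      show "compact ({0..M} - (\<Union>z\<in>Z. B z))" by (rule compact_diff) (auto simp: B_def)
      show "continuous_on ({0..M} - (\<Union>z\<in>Z. B z)) F" using cF by (simp add: continuous_at_imp_continuous_on)
      fix x assume x: "x \<in> {0..M} - (\<Union>z\<in>Z. B z)"
      have "x \<in> B x" using \<epsilon> by (simp add: B_def)
      thus "F x \<noteq> 0" using x by (auto simp: Z_def)
    qed auto
    ultimately show ?thesis unfolding E_def by eventually_elim blast
  qed
  have unique: "a = b" if "E n" "z \<in> Z" "\<bar>a - z\<bar> < \<epsilon>" "\<bar>b - z\<bar> < \<epsilon>" "p n a = 0" "p n b = 0" for a b n z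
    using that(3-6)
  proof (induction a b rule: linorder_wlog)
    case (le a b)
    show ?case
    proof (rule ccontr)
      assume "a \<noteq> b"
      with le have "a < b" by simp
      then obtain t where t: "a < t" "t < b" "p n b - p n a = (b - a) * p1 n t"
        using MVT2[of a b "p n" "p1 n"] dp by blast
      hence "p1 n t = 0" using le \<open>a < b\<close> by simp
      moreover have "t \<in> {z-\<epsilon>..z+\<epsilon>}" using t le by (auto simp: abs_less_iff)
      ultimately show False using that by (auto simp: E_def)
    qed
  qed auto

  define \<alpha> where "\<alpha> n z = (SOME a. \<bar>a - z\<bar> < \<epsilon> \<and> p n a = 0)" for n z
  have \<alpha>: "\<bar>\<alpha> n z - z\<bar> < \<epsilon>" "p n (\<alpha> n z) = 0" if "E n" "z \<in> Z" for n z
  proof -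
    have "\<exists>a. \<bar>a - z\<bar> < \<epsilon> \<and> p n a = 0" using that by (simp add: E_def)
    from someI_ex[OF this] show "\<bar>\<alpha> n z - z\<bar> < \<epsilon>" "p n (\<alpha> n z) = 0" by (simp_all add: \<alpha>_def)
  qed
  have bij: "bij_betw (\<alpha> n) Z {a. a \<in> {0..M} \<and> p n a = 0}" if n: "E n" for n
    unfolding bij_betw_def
  proof (intro conjI subset_antisym subsetI)
    show "inj_on (\<alpha> n) Z"
    proof (rule inj_onI, rule ccontr)
      fix z z' assume *: "z \<in> Z" "z' \<in> Z" "\<alpha> n z = \<alpha> n z'" "z \<noteq> z'"
      thus False using sep[of z z'] \<alpha>(1)[OF n, of z] \<alpha>(1)[OF n, of z'] by linarith
    qed
  next
    fix a assume "a \<in> \<alpha> n ` Z"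
    then obtain z where z: "z \<in> Z" "a = \<alpha> n z" by auto
    have "a \<in> B z" using \<alpha>[OF n z(1)] z by (auto simp: B_def abs_less_iff)
    thus "a \<in> {a. a \<in> {0..M} \<and> p n a = 0}" using Bin[OF z(1)] \<alpha>[OF n z(1)] z by auto
  next
    fix a assume a: "a \<in> {a. a \<in> {0..M} \<and> p n a = 0}"
    moreover have "\<forall>x\<in>{0..M} - (\<Union>z\<in>Z. B z). p n x \<noteq> 0" using n by (simp add: E_def)
    ultimately obtain z where z: "z \<in> Z" "a \<in> B z" by blast
    have "a = \<alpha> n z" by (rule unique[OF n z(1)]) (use a z \<alpha>[OF n z(1)] in \<open>auto simp: B_def\<close>)
    thus "a \<in> \<alpha> n ` Z" using z by auto
  qed
  have lim: "(\<lambda>n. \<alpha> n z) \<longlonglongrightarrow> z" if z: "z \<in> Z" for z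
  proof (rule tendstoI)
    fix \<eta> :: real assume "\<eta> > 0"
    define \<eta>' where "\<eta>' = min \<eta> \<epsilon>"
    have \<eta>': "\<eta>' > 0" "\<eta>' \<le> \<epsilon>" "\<eta>' \<le> \<eta>" using \<epsilon> \<open>\<eta> > 0\<close> by (auto simp: \<eta>'_def)
    show "eventually (\<lambda>n. dist (\<alpha> n z) z < \<eta>) sequentially"
      using exists_zero[OF z \<eta>'(1,2)] evE
    proof eventually_elim
      case (elim n)
      then obtain a where a: "\<bar>a - z\<bar> < \<eta>'" "p n a = 0" by auto
      have "\<alpha> n z = a" by (rule unique[OF elim(2) z]) (use a \<alpha>[OF elim(2) z] \<eta>' in auto)
      thus ?case using a \<eta>' by (simp add: dist_real_def)
    qed
  qed
  have "(\<lambda>n. \<Sum>z\<in>Z. g (\<alpha> n z)) \<longlonglongrightarrow> (\<Sum>z\<in>Z. g z)"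
    by (intro tendsto_sum isCont_tendsto_compose[OF g] lim)
  thus ?thesis
  proof (rule Lim_transform_eventually)
    show "eventually (\<lambda>n. (\<Sum>z\<in>Z. g (\<alpha> n z)) = (\<Sum>a | a \<in> {0..M} \<and> p n a = 0. g a)) sequentially"
      using evE by eventually_elim (rule sum.reindex_bij_betw[OF bij])
  qed
qed

text \<open>
  The roots of \<open>P n\<close> beyond \<open>M\<close> contribute at most \<open>4 * C / M\<close>, because
  \<open>1 / (w - a)\<^sup>2 \<le> 4 / a\<^sup>2 \<le> (4 / M) * (1 / a)\<close> for \<open>a > M > 2 * w\<close>; this is what the bound on the sums
  of reciprocals is for. The corresponding statement for \<open>F'/F\<close> and \<open>1 / (w - z)\<close> would be false in
  general, since roots escaping to infinity can leave a factor \<open>exp (- \<alpha> * w)\<close> in the limit; the second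
  logarithmic derivative does not see that factor.
\<close>
theorem has_sum_inverse_squares_of_zeros:
  fixes P :: "nat \<Rightarrow> real poly" and A :: "nat \<Rightarrow> real set" and F F1 F2 :: "real \<Rightarrow> real"
  assumes fin: "\<And>n. finite (A n)" and pos: "\<And>n a. a \<in> A n \<Longrightarrow> a > 0"
    and P: "\<And>n. P n = smult (c n) (\<Prod>a\<in>A n. [:- a, 1:])" and c: "\<And>n. c n \<noteq> 0"
    and C: "\<And>n. (\<Sum>a\<in>A n. 1 / a) \<le> C"
    and u0: "\<And>M. uniform_limit {0..M} (\<lambda>n. poly (P n)) F sequentially"
    and u1: "\<And>M. uniform_limit {0..M} (\<lambda>n. poly (pderiv (P n))) F1 sequentially"
    and u2: "(\<lambda>n. poly (pderiv (pderiv (P n))) w) \<longlonglongrightarrow> F2 w"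
    and dF: "\<And>x. (F has_real_derivative F1 x) (at x)"
    and cF1: "\<And>x. isCont F1 x"
    and F0: "F 0 \<noteq> 0" 
    and simple: "\<And>x. x > 0 \<Longrightarrow> F x = 0 \<Longrightarrow> F1 x \<noteq> 0"
    and w: "w \<ge> 0" "F w \<noteq> 0"
  shows "((\<lambda>z. 1 / (w - z)\<^sup>2) has_sum ((F1 w)\<^sup>2 - F w * F2 w) / (F w)\<^sup>2) {z. z > 0 \<and> F z = 0}"
proof -
  define L where "L = ((F1 w)\<^sup>2 - F w * F2 w) / (F w)\<^sup>2"
  define g where "g z = 1 / (w - z)\<^sup>2" for z
  define Z where "Z M = {x \<in> {0..M}. F x = 0}" for M
  have g0: "g z \<ge> 0" for z by (simp add: g_def)
  have simple': "F1 x \<noteq> 0" if "x \<ge> 0" "F x = 0" for x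
    using simple[of x] F0 that by (cases "x = 0") auto
  have finZ: "finite (Z M)" for M unfolding Z_def
    by (rule simple_zeros_finite[of _ _ F F1]) (use dF simple' in auto)
  have roots: "poly (P n) a = 0 \<longleftrightarrow> a \<in> A n" for n a
    using fin[of n] c[of n] by (auto simp: P poly_prod)
  have lim0: "(\<lambda>n. poly (P n) w) \<longlonglongrightarrow> F w"
    using tendsto_uniform_limitI[OF u0[of w], of w] w by simp
  have lim1: "(\<lambda>n. poly (pderiv (P n)) w) \<longlonglongrightarrow> F1 w"
    using tendsto_uniform_limitI[OF u1[of w], of w] w by simp
  have "(\<lambda>n. ((poly (pderiv (P n)) w)\<^sup>2 - poly (P n) w * poly (pderiv (pderiv (P n))) w) / (poly (P n) w)\<^sup>2)
     \<longlonglongrightarrow> L" unfolding L_def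
    by (intro tendsto_intros lim0 lim1 u2) (use w in auto)
  moreover have "eventually (\<lambda>n. poly (P n) w \<noteq> 0) sequentially"
    by (rule tendsto_imp_eventually_ne[OF lim0 w(2)])
  hence "eventually (\<lambda>n. ((poly (pderiv (P n)) w)\<^sup>2 - poly (P n) w * poly (pderiv (pderiv (P n))) w) / (poly (P n) w)\<^sup>2
      = (\<Sum>a\<in>A n. g a)) sequentially"
  proof eventually_elim
    case (elim n)
    let ?q = "\<Prod>a\<in>A n. [:- a, 1:]"
    have "w \<notin> A n" using elim roots by auto
    from log_deriv_derivative_prod[OF fin this]
    have *: "(poly (pderiv ?q) w)\<^sup>2 - poly ?q w * poly (pderiv (pderiv ?q)) w = (poly ?q w)\<^sup>2 * (\<Sum>a\<in>A n. g a)"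
      by (simp add: g_def)
    have "(poly (pderiv (P n)) w)\<^sup>2 - poly (P n) w * poly (pderiv (pderiv (P n))) w
      = (c n)\<^sup>2 * ((poly (pderiv ?q) w)\<^sup>2 - poly ?q w * poly (pderiv (pderiv ?q)) w)"
      by (simp add: P pderiv_smult power2_eq_square algebra_simps)
    also have "\<dots> = (poly (P n) w)\<^sup>2 * (\<Sum>a\<in>A n. g a)"
      unfolding * by (simp add: P power_mult_distrib)
    finally show ?case using elim by simp
  qed
  ultimately have limL: "(\<lambda>n. \<Sum>a\<in>A n. g a) \<longlonglongrightarrow> L" by (rule Lim_transform_eventually)
  have C0: "C \<ge> 0" using order_trans[OF sum_nonneg C[of 0]] pos by (simp add: less_imp_le)

  have bounds: "(\<Sum>z\<in>Z M. g z) \<le> L" "L \<le> (\<Sum>z\<in>Z M. g z) + 4 * C / M"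
    if M: "M > 2 * w" "M > 0" "F M \<noteq> 0" for M
  proof -
    have tail: "(\<Sum>a\<in>A n - {..M}. g a) \<le> 4 * C / M" for n
    proof -
      have "(\<Sum>a\<in>A n - {..M}. g a) \<le> (\<Sum>a\<in>A n - {..M}. 4 / M * (1 / a))"
      proof (rule sum_mono)
        fix a assume "a \<in> A n - {..M}"
        hence a: "a > M" by auto
        hence "M * a \<le> a\<^sup>2" using M by (simp add: power2_eq_square)
        moreover have "(a / 2)\<^sup>2 \<le> (a - w)\<^sup>2" using a M w by (intro power_mono) auto
        ultimately have "M * a / 4 \<le> (w - a)\<^sup>2" by (simp add: power_divide power2_commute)
        hence "g a \<le> 1 / (M * a / 4)" unfolding g_def using a M
          by (intro divide_left_mono) (auto intro!: mult_pos_pos)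
        thus "g a \<le> 4 / M * (1 / a)" by simp
      qed
      also have "\<dots> \<le> (\<Sum>a\<in>A n. 4 / M * (1 / a))"
        by (rule sum_mono2) (use fin pos M in \<open>auto simp: less_imp_le\<close>)
      also have "\<dots> = 4 / M * (\<Sum>a\<in>A n. 1 / a)" by (simp add: sum_distrib_left)
      also have "\<dots> \<le> 4 / M * C" using C[of n] M by (intro mult_left_mono) auto
      finally show ?thesis by simp
    qed
    have split: "(\<Sum>a\<in>A n. g a) = (\<Sum>a\<in>A n \<inter> {..M}. g a) + (\<Sum>a\<in>A n - {..M}. g a)" for n
      using sum.Int_Diff[OF fin] .
    have "(\<lambda>n. \<Sum>a | a \<in> {0..M} \<and> poly (P n) a = 0. g a) \<longlonglongrightarrow> (\<Sum>z\<in>Z M. g z)"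
      unfolding Z_def
    proof (rule sum_over_zeros_tendsto[OF u0 u1 dF cF1 poly_DERIV F0 M(3)])
      fix z assume "z \<in> {x \<in> {0..M}. F x = 0}"
      hence "w \<noteq> z" using w by auto
      thus "isCont g z" unfolding g_def by (intro continuous_intros) auto
    qed (use simple' in auto)
    moreover have "{a. a \<in> {0..M} \<and> poly (P n) a = 0} = A n \<inter> {..M}" for n
      using pos[of _ n] by (auto simp: roots less_imp_le)
    ultimately have limM: "(\<lambda>n. \<Sum>a\<in>A n \<inter> {..M}. g a) \<longlonglongrightarrow> (\<Sum>z\<in>Z M. g z)" by simp
    show "(\<Sum>z\<in>Z M. g z) \<le> L"
      by (rule LIMSEQ_le[OF limM limL]) (use split g0 in \<open>auto intro!: sum_nonneg\<close>)
    show "L \<le> (\<Sum>z\<in>Z M. g z) + 4 * C / M"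
      by (rule LIMSEQ_le[OF limL tendsto_add[OF limM tendsto_const]]) (use split tail in auto)
  qed
  have exM: "\<exists>M>B. M > 2 * w \<and> M > 0 \<and> F M \<noteq> 0" for B
  proof -
    \<comment> \<open>The zeros of \<open>F\<close> up to \<open>B' + 1\<close> are finite in number, so they do not fill an interval.\<close>
  define B' where "B' = max B (max (2 * w) 0)"
    have "infinite ({B'<..<B'+1} - Z (B'+1))" using finZ by (intro Diff_infinite_finite) auto
    then obtain M where "M \<in> {B'<..<B'+1} - Z (B'+1)" by (metis ex_in_conv finite.emptyI)
    thus ?thesis by (intro exI[of _ M]) (auto simp: Z_def B'_def)
  qed
  have "((\<lambda>z. g z) has_sum L) {z. z > 0 \<and> F z = 0}"
    unfolding has_sum_def
  proof (rule order_tendstoI)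
    fix a assume "a < L"
    define B where "B = 4 * C / (L - a)"
    obtain M where M: "M > B" "M > 2 * w" "M > 0" "F M \<noteq> 0" using exM[of B] by blast
    have "4 * C / M < L - a" using M(1,3) \<open>a < L\<close> by (simp add: B_def field_simps)
    hence a: "a < (\<Sum>z\<in>Z M. g z)" using bounds(2)[OF M(2-4)] by simp
    show "eventually (\<lambda>Y. a < sum g Y) (finite_subsets_at_top {z. z > 0 \<and> F z = 0})"
      unfolding eventually_finite_subsets_at_top
    proof (intro exI[of _ "Z M"] conjI allI impI)
      show "Z M \<subseteq> {z. z > 0 \<and> F z = 0}" using F0 by (auto simp: Z_def order_le_less)
      fix Y assume Y: "finite Y \<and> Z M \<subseteq> Y \<and> Y \<subseteq> {z. z > 0 \<and> F z = 0}"
      have "sum g (Z M) \<le> sum g Y" by (rule sum_mono2) (use Y g0 in auto)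
      thus "a < sum g Y" using a by simp
    qed (rule finZ)
  next
    fix a assume "a > L"
    show "eventually (\<lambda>Y. sum g Y < a) (finite_subsets_at_top {z. z > 0 \<and> F z = 0})"
      unfolding eventually_finite_subsets_at_top
    proof (intro exI[of _ "{}"] conjI allI impI)
      fix Y assume Y: "finite Y \<and> {} \<subseteq> Y \<and> Y \<subseteq> {z. z > 0 \<and> F z = 0}"
      obtain M where M: "M > Max (insert 0 Y)" "M > 2 * w" "M > 0" "F M \<noteq> 0" using exM by blast
      have "y \<le> M" if "y \<in> Y" for y using M(1) Max_ge[of "insert 0 Y" y] Y that by auto
      hence "Y \<subseteq> Z M" using Y by (auto simp: Z_def)
      hence "sum g Y \<le> sum g (Z M)" by (intro sum_mono2 finZ) (auto simp: g0)
      also have "\<dots> \<le> L" by (rule bounds(1)[OF M(2-4)])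
      finally show "sum g Y < a" using \<open>a > L\<close> by simp
    qed auto
  qed
  thus ?thesis unfolding L_def g_def .
qed

section \<open>Laguerre polynomials\<close>

text \<open>
  The Laguerre polynomial with parameter \<open>\<mu>\<close>, normalised to have the value 1 at 0.
\<close>
definition laguerre_poly :: "real \<Rightarrow> nat \<Rightarrow> real poly" where
  "laguerre_poly \<mu> n = (\<Sum>m\<le>n. monom ((- 1) ^ m * real (n choose m) / pochhammer (\<mu> + 1) m) m)"

lemma coeff_laguerre_poly:
  "coeff (laguerre_poly \<mu> n) m = (- 1) ^ m * real (n choose m) / pochhammer (\<mu> + 1) m"
  by (cases "m \<le> n") (auto simp: laguerre_poly_def coeff_sum binomial_eq_0 not_le)

lemma binomial_Suc_times:
  "(1 + real k) * real (n choose Suc k) = (real n - real k) * real (n choose k)"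
proof (cases "k \<le> n")
  case True
  have "Suc k * (n choose Suc k) = (n - k) * (n choose k)"
    by (rule binomial_absorb_comp[symmetric, of n k, unfolded binomial_absorption[symmetric]])
  thus ?thesis using True by (metis of_nat_Suc of_nat_diff of_nat_mult)
qed (simp add: binomial_eq_0)

lemma laguerre_poly_raise:
  assumes "\<mu> > -1"
  shows "smult (\<mu> + 1 + real n) (laguerre_poly \<mu> (Suc n)) =
           [:real n + 1 + \<mu>, - 1:] * laguerre_poly \<mu> n + [:0, 1:] * pderiv (laguerre_poly \<mu> n)"
proof (rule poly_eqI)
  fix m
  show "coeff (smult (\<mu> + 1 + real n) (laguerre_poly \<mu> (Suc n))) m =
     coeff ([:real n + 1 + \<mu>, - 1:] * laguerre_poly \<mu> n + [:0, 1:] * pderiv (laguerre_poly \<mu> n)) m"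
  proof (cases m)
    case 0
    thus ?thesis by (simp add: coeff_laguerre_poly)
  next
    case (Suc k)
    define p where "p = pochhammer (\<mu> + 1) k"
    have nz: "p \<noteq> 0" "\<mu> + 1 + real k \<noteq> 0"
      using pochhammer_pos[of "\<mu> + 1" k] assms by (simp_all add: p_def)
    have ck: "coeff (laguerre_poly \<mu> n) k = (-1) ^ k * real (n choose k) / p" for n
      by (simp add: coeff_laguerre_poly p_def)
    have cSuc: "coeff (laguerre_poly \<mu> n) (Suc k)
        = - ((-1) ^ k * real (n choose Suc k) / (p * (\<mu> + 1 + real k)))" for n
      by (simp add: coeff_laguerre_poly p_def pochhammer_Suc)
    have alg: "(\<mu> + 1 + N) * - (s * (C + C') / (p * (\<mu> + 1 + K)))
        = (N + 1 + \<mu>) * - (s * C' / (p * (\<mu> + 1 + K))) - s * C / p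
            + (1 + K) * - (s * C' / (p * (\<mu> + 1 + K)))"
      if "(1 + K) * C' = (N - K) * C" "\<mu> + 1 + K \<noteq> 0" for N K C C' s :: real
    proof -
      have "(\<mu> + 1 + N) * (C + C') = (N + 1 + \<mu>) * C' + (\<mu> + 1 + K) * C + (1 + K) * C'"
        using that(1) by (simp add: algebra_simps)
      hence "- (s / (p * (\<mu> + 1 + K))) * ((\<mu> + 1 + N) * (C + C'))
          = - (s / (p * (\<mu> + 1 + K))) * ((N + 1 + \<mu>) * C' + (\<mu> + 1 + K) * C + (1 + K) * C')"
        by simp
      thus ?thesis using that(2) nz(1) by (simp add: divide_simps) algebra
    qed
    show ?thesis
      using alg[OF binomial_Suc_times nz(2), where s = "(-1) ^ k"]
      by (simp add: Suc coeff_pderiv ck cSuc)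
  qed
qed

lemma degree_laguerre_poly:
  assumes "\<mu> > -1" 
  shows "degree (laguerre_poly \<mu> n) = n"
proof (rule antisym)
  show "degree (laguerre_poly \<mu> n) \<le> n"
    by (rule degree_le) (simp add: coeff_laguerre_poly binomial_eq_0)
  show "n \<le> degree (laguerre_poly \<mu> n)"
    by (rule le_degree) (use pochhammer_pos[of "\<mu> + 1" n] assms in \<open>simp add: coeff_laguerre_poly\<close>)
qed

lemma laguerre_poly_sign_at_top:
  assumes "\<mu> > -1"
  shows "\<exists>b. \<forall>x\<ge>b. (- 1) ^ n * poly (laguerre_poly \<mu> n) x > 0"
proof -
  let ?p = "smult ((- 1) ^ n) (laguerre_poly \<mu> n)"
  have "lead_coeff ?p = 1 / pochhammer (\<mu> + 1) n"
    by (simp add: degree_laguerre_poly[OF assms] coeff_laguerre_poly flip: power_add mult_2)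
  hence "lead_coeff ?p > 0" using pochhammer_pos[of "\<mu> + 1" n] assms by simp
  from poly_pinfty_gt_lc[OF this] this show ?thesis
    by (metis less_le_trans poly_smult)
qed

text \<open>
  The raising recurrence in the form of Rodrigues' formula, ready for Rolle's theorem.
\<close>
lemma laguerre_weighted_deriv:
  assumes "\<mu> > -1" "x > 0"
  shows "((\<lambda>x. x powr (real n + 1 + \<mu>) * exp (- x) * poly (laguerre_poly \<mu> n) x) has_real_derivative
           (\<mu> + 1 + real n) * (x powr (real n + \<mu>) * exp (- x)) * poly (laguerre_poly \<mu> (Suc n)) x) (at x)"
proof -
  let ?q = "poly (laguerre_poly \<mu> n) x" and ?q' = "poly (pderiv (laguerre_poly \<mu> n)) x"
  have rec: "(\<mu> + 1 + real n) * poly (laguerre_poly \<mu> (Suc n)) x = (real n + 1 + \<mu> - x) * ?q + x * ?q'"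
    using arg_cong[OF laguerre_poly_raise[OF assms(1), of n], of "\<lambda>p. poly p x"]
    by (simp add: algebra_simps)
  have pw: "x powr (real n + 1 + \<mu>) = x * x powr (real n + \<mu>)"
    using assms powr_add[of x 1 "real n + \<mu>"] by (simp add: add_ac)
  have "((\<lambda>x. x powr (real n + 1 + \<mu>) * exp (- x) * poly (laguerre_poly \<mu> n) x) has_real_derivative
      ((real n + 1 + \<mu>) * x powr (real n + 1 + \<mu> - 1) * exp (- x)
        + x powr (real n + 1 + \<mu>) * (exp (- x) * - 1)) * ?q
        + x powr (real n + 1 + \<mu>) * exp (- x) * ?q') (at x)"
    using assms by (auto intro!: derivative_eq_intros has_real_derivative_powr poly_DERIV)
  also have "((real n + 1 + \<mu>) * x powr (real n + 1 + \<mu> - 1) * exp (- x)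
        + x powr (real n + 1 + \<mu>) * (exp (- x) * - 1)) * ?q
        + x powr (real n + 1 + \<mu>) * exp (- x) * ?q'
      = x powr (real n + \<mu>) * exp (- x) * ((real n + 1 + \<mu> - x) * ?q + x * ?q')"
    unfolding pw by (simp add: algebra_simps)
  also have "\<dots> = (\<mu> + 1 + real n) * (x powr (real n + \<mu>) * exp (- x)) * poly (laguerre_poly \<mu> (Suc n)) x"
    unfolding rec[symmetric] by (simp only: mult_ac)
  finally show ?thesis .
qed

text \<open>
  The weighted polynomial \<open>f\<close> of degree \<open>n\<close> vanishes at 0 and at the \<open>n\<close> roots, and its derivative is
  a positive multiple of the next polynomial. Rolle's theorem gives \<open>n\<close> roots in the gaps. The last
  root lies to the right of \<open>a n\<close>: otherwise \<open>f\<close>, which vanishes at \<open>a n\<close>, would be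
  monotone from there on and take the sign that the next polynomial has at infinity, whereas the
  leading coefficients of consecutive polynomials have opposite signs.
  The value \<open>a 0 = 0\<close> is the left end of the first gap and not a root.
\<close>
lemma laguerre_roots_listed:
  assumes "\<mu> > -1"
  shows "\<exists>a :: nat \<Rightarrow> real. a 0 = 0 \<and> (\<forall>i<n. a i < a (Suc i)) \<and>
           (\<forall>i\<in>{1..n}. poly (laguerre_poly \<mu> n) (a i) = 0)"
proof (induction n)
  case 0
  show ?case by (intro exI[of _ "\<lambda>_. 0"]) auto
next
  case (Suc n)
  then obtain a where a: "a 0 = 0" "\<And>i. i < n \<Longrightarrow> a i < a (Suc i)"
    "\<And>i. i \<in> {1..n} \<Longrightarrow> poly (laguerre_poly \<mu> n) (a i) = 0" by blast
  define f where "f x = x powr (real n + 1 + \<mu>) * exp (- x) * poly (laguerre_poly \<mu> n) x" for x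
  define f' where "f' x = (\<mu> + 1 + real n) * (x powr (real n + \<mu>) * exp (- x)) * poly (laguerre_poly \<mu> (Suc n)) x" for x
  have df: "(f has_real_derivative f' x) (at x)" if "x > 0" for x
    unfolding f_def[abs_def] f'_def using laguerre_weighted_deriv[OF assms that] .
  have f'0: "f' x = 0 \<longleftrightarrow> poly (laguerre_poly \<mu> (Suc n)) x = 0" if "x > 0" for x
    using assms that by (simp add: f'_def)
  have a0: "a i \<ge> 0" if "i \<le> n" for i
    using that
  proof (induction i)
    case (Suc i)
    thus ?case using a(2)[of i] by force
  qed (simp add: a)
  have fa: "f (a i) = 0" if "i \<le> n" for i
    using that a(1) a(3)[of i] by (cases "i = 0") (auto simp: f_def)
  have contf: "continuous_on {u..v} f" if "u \<ge> 0" for u v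
    unfolding f_def[abs_def]
    using that assms by (intro continuous_intros continuous_on_powr') auto
  have step: "\<exists>b. a i < b \<and> b < a (Suc i) \<and> poly (laguerre_poly \<mu> (Suc n)) b = 0" if i: "i < n" for i
  proof -
    have "\<exists>l z. a i < z \<and> z < a (Suc i) \<and> (f has_real_derivative l) (at z) \<and> f (a (Suc i)) - f (a i) = (a (Suc i) - a i) * l"
      by (rule MVT[OF a(2)[OF i] contf])
         (use a0[of i] i df in \<open>auto simp: real_differentiable_def intro: less_trans le_less_trans\<close>)
    then obtain l z where z: "a i < z" "z < a (Suc i)" "(f has_real_derivative l) (at z)"
      "f (a (Suc i)) - f (a i) = (a (Suc i) - a i) * l" by blast
    have "z > 0" using z(1) a0[of i] i by linarith
    have "l = 0" using z(1,2,4) fa[of i] fa[of "Suc i"] i by simp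
    moreover have "l = f' z" using DERIV_unique[OF z(3) df[OF \<open>z > 0\<close>]] .
    ultimately have "poly (laguerre_poly \<mu> (Suc n)) z = 0" using f'0[OF \<open>z > 0\<close>] by simp
    thus ?thesis using z by blast
  qed
  have last: "\<exists>b. a n < b \<and> poly (laguerre_poly \<mu> (Suc n)) b = 0"
  proof (rule ccontr)
    assume no: "\<not> ?thesis"
    let ?s = "(- 1 :: real) ^ n"
    obtain b1 where b1: "\<And>x. x \<ge> b1 \<Longrightarrow> ?s * poly (laguerre_poly \<mu> n) x > 0"
      using laguerre_poly_sign_at_top[OF assms, of n] by blast
    obtain b2 where b2: "\<And>x. x \<ge> b2 \<Longrightarrow> - ?s * poly (laguerre_poly \<mu> (Suc n)) x > 0"
      using laguerre_poly_sign_at_top[OF assms, of "Suc n"] by auto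
    define B where "B = Max {b1, b2, a n + 1}"
    have B: "B \<ge> b1" "B \<ge> b2" "B > a n" by (auto simp: B_def max_def)
    have B0: "B > 0" using B(3) a0[of n] by simp
    have neg: "?s * poly (laguerre_poly \<mu> (Suc n)) t < 0" if t: "a n < t" "t \<le> B" for t
    proof (rule ccontr)
      assume "\<not> ?thesis"
      hence "\<exists>x\<ge>t. x \<le> B \<and> ?s * poly (laguerre_poly \<mu> (Suc n)) x = 0"
        using b2[OF B(2)] t by (intro IVT2) (auto intro!: continuous_intros)
      thus False using no t by force
    qed
    have "\<exists>l z. a n < z \<and> z < B \<and> (f has_real_derivative l) (at z) \<and> f B - f (a n) = (B - a n) * l"
      by (rule MVT[OF B(3) contf])
         (use a0[of n] df in \<open>auto simp: real_differentiable_def intro: less_trans le_less_trans\<close>)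
    then obtain l z where z: "a n < z" "z < B" "(f has_real_derivative l) (at z)"
      "f B = (B - a n) * l" using fa[of n] by auto
    have z0: "z > 0" using z(1) a0[of n] by linarith
    have l: "l = f' z" using DERIV_unique[OF z(3) df[OF z0]] .
    have "?s * f B = (B - a n) * ((\<mu> + 1 + real n) * (z powr (real n + \<mu>) * exp (- z))) *
            (?s * poly (laguerre_poly \<mu> (Suc n)) z)"
      unfolding z(4) l f'_def by (simp only: mult_ac)
    also have "\<dots> < 0"
    proof (rule mult_pos_neg)
      show "(B - a n) * ((\<mu> + 1 + real n) * (z powr (real n + \<mu>) * exp (- z))) > 0"
        using z z0 assms by simp
    qed (use z neg[of z] in auto)
    finally have "?s * f B < 0" .
    moreover have "?s * f B = B powr (real n + 1 + \<mu>) * exp (- B) * (?s * poly (laguerre_poly \<mu> n) B)"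
      unfolding f_def by (simp only: mult_ac)
    moreover have "B powr (real n + 1 + \<mu>) * exp (- B) * (?s * poly (laguerre_poly \<mu> n) B) > 0"
      using b1[OF B(1)] B0 by (intro mult_pos_pos[of "_ * _" "_ * _"]) auto
    ultimately show False by simp
  qed
  obtain b where b: "\<And>i. i < n \<Longrightarrow> a i < b i \<and> b i < a (Suc i) \<and> poly (laguerre_poly \<mu> (Suc n)) (b i) = 0"
    using step by metis
  obtain bn where bn: "a n < bn" "poly (laguerre_poly \<mu> (Suc n)) bn = 0" using last by blast
  define d where "d i = (if i = 0 then 0 else if i = Suc n then bn else b (i - 1))" for i
  show ?case
  proof (intro exI[of _ d] conjI allI impI ballI)
    show "d 0 = 0" by (simp add: d_def)
    fix i assume i: "i < Suc n"
    show "d i < d (Suc i)"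
    proof (cases i)
      case 0
      show ?thesis using 0 a(1) b[of 0] bn by (cases n) (auto simp: d_def)
    next
      case (Suc j)
      have j: "j < n" using Suc i by simp
      have "a (Suc j) < d (Suc (Suc j))"
      proof (cases "Suc j = n")
        case True
        thus ?thesis using bn by (simp add: d_def)
      next
        case False
        thus ?thesis using b[of "Suc j"] j by (simp add: d_def)
      qed
      thus ?thesis using Suc j b[OF j] by (simp add: d_def)
    qed
  next
    fix i assume "i \<in> {1..Suc n}"
    thus "poly (laguerre_poly \<mu> (Suc n)) (d i) = 0"
      using b[of "i - 1"] bn by (auto simp: d_def)
  qed
qed

lemma laguerre_roots:
  assumes "\<mu> > -1"
  obtains A where "finite A" "card A = n" "\<And>a. a \<in> A \<Longrightarrow> a > 0 \<and> poly (laguerre_poly \<mu> n) a = 0"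
proof -
  obtain a where a: "a 0 = 0" "\<And>i. i < n \<Longrightarrow> a i < a (Suc i)"
    "\<And>i. i \<in> {1..n} \<Longrightarrow> poly (laguerre_poly \<mu> n) (a i) = 0"
    using laguerre_roots_listed[OF assms, of n] by blast
  have less: "a i < a j" if "i < j" "j \<le> n" for i j
    using that
  proof (induction j)
    case (Suc j)
    thus ?case using a(2)[of j] by (cases "i = j") (auto intro: less_trans)
  qed simp
  have "inj_on a {1..n}"
  proof (rule inj_onI)
    fix i j assume ij: "i \<in> {1..n}" "j \<in> {1..n}" "a i = a j"
    show "i = j" using less[of i j] less[of j i] ij by (cases i j rule: linorder_cases) auto
  qed
  moreover have "a i > 0" if "i \<in> {1..n}" for i using less[of 0 i] a(1) that by auto
  ultimately show ?thesis
    by (intro that[of "a ` {1..n}"]) (auto simp: card_image a(3))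
qed

section \<open>The entire function behind the Bessel function\<close>

definition bessel_coeff :: "real \<Rightarrow> nat \<Rightarrow> real" where
  "bessel_coeff \<mu> m = (- 1) ^ m / (fact m * pochhammer (\<mu> + 1) m)"

text \<open>
  The hypergeometric function \<open>\<^sub>0F\<^sub>1(; \<mu> + 1; - w)\<close>.
\<close>
definition bessel_entire :: "real \<Rightarrow> real \<Rightarrow> real" where
  "bessel_entire \<mu> w = (\<Sum>m. bessel_coeff \<mu> m * w ^ m)"

lemma abs_bessel_coeff:
  assumes "\<mu> > -1"
  shows "\<bar>bessel_coeff \<mu> m\<bar> = 1 / (fact m * pochhammer (\<mu> + 1) m)"
  using pochhammer_pos[of "\<mu> + 1" m] assms by (simp add: bessel_coeff_def abs_mult power_abs)

lemma summable_abs_bessel_coeff: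
  assumes "\<mu> > -1"
  shows "summable (\<lambda>m. \<bar>bessel_coeff \<mu> m\<bar> * r ^ m)"
proof -
  \<comment> \<open>From \<open>N\<close> on, the ratio of consecutive terms is at most one half.\<close>
  obtain N :: nat where N: "2 * \<bar>r\<bar> / (\<mu> + 1) \<le> real N" using real_arch_simple by blast
  show ?thesis
  proof (rule summable_ratio_test[of "1/2" N])
    fix m assume m: "m \<ge> N"
    have p: "pochhammer (\<mu> + 1) m > 0" using assms by (simp add: pochhammer_pos)
    have "2 * \<bar>r\<bar> \<le> real N * (\<mu> + 1)" using N assms by (simp add: field_simps)
    also have "\<dots> \<le> (1 + real m) * (\<mu> + 1 + real m)" using m assms by (intro mult_mono) auto
    finally have r: "2 * \<bar>r\<bar> \<le> (1 + real m) * (\<mu> + 1 + real m)" .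
    have d: "(1 + real m) * (\<mu> + 1 + real m) > 0" using assms by (intro mult_pos_pos) auto
    have "norm (\<bar>bessel_coeff \<mu> (Suc m)\<bar> * r ^ Suc m)
        = \<bar>r\<bar> / ((1 + real m) * (\<mu> + 1 + real m)) * norm (\<bar>bessel_coeff \<mu> m\<bar> * r ^ m)"
      unfolding norm_mult abs_bessel_coeff[OF assms]
      by (simp add: pochhammer_Suc abs_mult power_abs assms p[THEN less_imp_le] mult_ac)
         (use assms p in \<open>simp add: abs_of_pos\<close>)
    also have "\<dots> \<le> 1 / 2 * norm (\<bar>bessel_coeff \<mu> m\<bar> * r ^ m)"
      using r d by (intro mult_right_mono) (auto simp: divide_simps)
    finally show "norm (\<bar>bessel_coeff \<mu> (Suc m)\<bar> * r ^ Suc m) \<le> 1 / 2 * norm (\<bar>bessel_coeff \<mu> m\<bar> * r ^ m)" .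
  qed simp
qed

lemma summable_bessel_coeff:
  assumes "\<mu> > -1"
  shows "summable (\<lambda>m. bessel_coeff \<mu> m * r ^ m)"
  using summable_abs_bessel_coeff[OF assms, of "\<bar>r\<bar>"]
  by (intro summable_rabs_cancel[of "\<lambda>m. bessel_coeff \<mu> m * r ^ m"]) (simp add: abs_mult power_abs)

lemma diffs_bessel_coeff:
  assumes "\<mu> > -1"
  shows "diffs (bessel_coeff \<mu>) m = - 1 / (\<mu> + 1) * bessel_coeff (\<mu> + 1) m"
proof -
  have gen: "N * (- 1 * s / (N * f * (a * q))) = - 1 / a * (s / (f * q))"
    if "N \<noteq> 0" "a \<noteq> 0" "q \<noteq> 0" "f \<noteq> 0" for N a q f s :: real
    using that by (simp add: divide_simps)
  have "\<mu> + 1 \<noteq> 0" using assms by simp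
  moreover have "pochhammer (\<mu> + 1 + 1) m \<noteq> 0" using pochhammer_pos[of "\<mu> + 1 + 1" m] assms by simp
  moreover have "real (Suc m) \<noteq> 0" by simp
  ultimately show ?thesis
    unfolding diffs_def bessel_coeff_def pochhammer_rec fact_Suc of_nat_mult power_Suc
    by (intro gen) auto
qed

lemma suminf_diffs_bessel_coeff:
  assumes "\<mu> > -1"
  shows "(\<Sum>m. diffs (bessel_coeff \<mu>) m * w ^ m) = - bessel_entire (\<mu> + 1) w / (\<mu> + 1)"
  using suminf_mult[OF summable_bessel_coeff[of "\<mu> + 1" w], of "- 1 / (\<mu> + 1)"] assms
  by (simp add: diffs_bessel_coeff[OF assms] bessel_entire_def mult.assoc)

lemma suminf_diffs_diffs_bessel_coeff:
  assumes "\<mu> > -1"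
  shows "(\<Sum>m. diffs (diffs (bessel_coeff \<mu>)) m * w ^ m) = bessel_entire (\<mu> + 2) w / ((\<mu> + 1) * (\<mu> + 2))"
proof -
  have "diffs (diffs (bessel_coeff \<mu>)) m = - 1 / (\<mu> + 1) * diffs (bessel_coeff (\<mu> + 1)) m" for m
    unfolding diffs_def[of "diffs _"] diffs_bessel_coeff[OF assms] by (simp add: diffs_def)
  hence "(\<Sum>m. diffs (diffs (bessel_coeff \<mu>)) m * w ^ m)
      = (\<Sum>m. - 1 / (\<mu> + 1) * (diffs (bessel_coeff (\<mu> + 1)) m * w ^ m))"
    by (simp only: mult.assoc)
  also have "\<dots> = - 1 / (\<mu> + 1) * (\<Sum>m. diffs (bessel_coeff (\<mu> + 1)) m * w ^ m)"
    using assms by (intro suminf_mult termdiff_converges_all summable_bessel_coeff) simp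
  also have "\<dots> = bessel_entire (\<mu> + 2) w / ((\<mu> + 1) * (\<mu> + 2))"
    using suminf_diffs_bessel_coeff[of "\<mu> + 1" w] assms by (simp add: add_ac)
  finally show ?thesis .
qed

lemma bessel_entire_0: "bessel_entire \<mu> 0 = 1"
  unfolding bessel_entire_def powser_zero by (simp add: bessel_coeff_def)

lemma DERIV_bessel_entire:
  assumes "\<mu> > -1"
  shows "(bessel_entire \<mu> has_real_derivative - bessel_entire (\<mu> + 1) w / (\<mu> + 1)) (at w)"
proof -
  have "bessel_entire \<mu> = (\<lambda>w. \<Sum>m. bessel_coeff \<mu> m * w ^ m)"
    by (rule ext) (rule bessel_entire_def)
  thus ?thesis
    using termdiffs_strong_converges_everywhere[OF summable_bessel_coeff[OF assms], of w]
    unfolding suminf_diffs_bessel_coeff[OF assms] by simp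
qed

lemma isCont_bessel_entire: "\<mu> > -1 \<Longrightarrow> isCont (bessel_entire \<mu>) w"
  using DERIV_bessel_entire by (rule DERIV_isCont)

lemma bessel_entire_contiguous:
  assumes "\<mu> > -1"
  shows "w * (bessel_entire (\<mu> + 2) w / ((\<mu> + 1) * (\<mu> + 2))) = bessel_entire (\<mu> + 1) w - bessel_entire \<mu> w"
proof -
  let ?d = "\<lambda>m. (bessel_coeff (\<mu> + 1) m - bessel_coeff \<mu> m) * w ^ m"
  have sums: "(\<lambda>m. bessel_coeff \<kappa> m * w ^ m) sums bessel_entire \<kappa> w" if "\<kappa> > -1" for \<kappa>
    unfolding bessel_entire_def using summable_bessel_coeff[OF that] by (rule summable_sums)
  have "?d sums (bessel_entire (\<mu> + 1) w - bessel_entire \<mu> w)"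
    using sums_diff[OF sums[of "\<mu> + 1"] sums[of \<mu>]] assms by (simp add: left_diff_distrib)
  moreover have "?d 0 = 0" by (simp add: bessel_coeff_def)
  ultimately have A: "(\<lambda>m. ?d (Suc m)) sums (bessel_entire (\<mu> + 1) w - bessel_entire \<mu> w)"
    using sums_Suc_iff[of ?d] by simp
  have "?d (Suc k) = w / ((\<mu> + 1) * (\<mu> + 2)) * (bessel_coeff (\<mu> + 2) k * w ^ k)" for k
  proof -
    define p where "p = pochhammer (\<mu> + 3) k"
    have p: "p \<noteq> 0" "\<mu> + 1 \<noteq> 0" "\<mu> + 2 \<noteq> 0" "\<mu> + 2 + real k \<noteq> 0"
      using pochhammer_pos[of "\<mu> + 3" k] assms by (auto simp: p_def)
    have p2: "pochhammer (\<mu> + 2) (Suc k) = (\<mu> + 2) * p"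
      using pochhammer_rec[of "\<mu> + 2" k] by (simp add: p_def add_ac)
    have "(\<mu> + 2 + real k) * pochhammer (\<mu> + 2) k = (\<mu> + 2) * p"
      using p2 pochhammer_rec'[of "\<mu> + 2" k] by simp
    hence p1: "pochhammer (\<mu> + 1) (Suc k) = (\<mu> + 1) * ((\<mu> + 2) * p / (\<mu> + 2 + real k))"
      using pochhammer_rec[of "\<mu> + 1" k] p by (simp add: field_simps add_ac)
    have a: "\<mu> + 1 + 1 = \<mu> + 2" "\<mu> + 2 + 1 = \<mu> + 3" by simp_all
    have c0: "bessel_coeff \<mu> (Suc k) = - ((-1) ^ k * (\<mu> + 2 + real k) / ((1 + real k) * fact k * ((\<mu> + 1) * (\<mu> + 2) * p)))"
      unfolding bessel_coeff_def p1 by (simp add: mult_ac)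
    have c1: "bessel_coeff (\<mu> + 1) (Suc k) = - ((-1) ^ k / ((1 + real k) * fact k * ((\<mu> + 2) * p)))"
      unfolding bessel_coeff_def a p2 by (simp add: mult_ac)
    have c2: "bessel_coeff (\<mu> + 2) k = (-1) ^ k / (fact k * p)"
      unfolding bessel_coeff_def a p_def ..
    have "bessel_coeff (\<mu> + 1) (Suc k) - bessel_coeff \<mu> (Suc k) = bessel_coeff (\<mu> + 2) k / ((\<mu> + 1) * (\<mu> + 2))"
    proof -
      define f where "f = (fact k :: real)"
      have f: "f \<noteq> 0" "1 + real k \<noteq> 0" by (auto simp: f_def)
      show ?thesis unfolding c0 c1 c2 f_def[symmetric] using p f
        by (simp add: divide_simps) (simp add: algebra_simps)
    qed
    thus ?thesis by (simp add: mult_ac)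
  qed
  hence "(\<lambda>m. ?d (Suc m)) = (\<lambda>k. w / ((\<mu> + 1) * (\<mu> + 2)) * (bessel_coeff (\<mu> + 2) k * w ^ k))" by blast
  moreover have "\<dots> sums (w / ((\<mu> + 1) * (\<mu> + 2)) * bessel_entire (\<mu> + 2) w)"
    using assms by (intro sums_mult sums) simp
  ultimately have "(\<lambda>m. ?d (Suc m)) sums (w / ((\<mu> + 1) * (\<mu> + 2)) * bessel_entire (\<mu> + 2) w)" by simp
  from sums_unique2[OF this A] show ?thesis by simp
qed

text \<open>
  With \<open>F' = - F\<^sub>\<mu>\<^sub>+\<^sub>1 / (\<mu> + 1)\<close> and \<open>F'' = F\<^sub>\<mu>\<^sub>+\<^sub>2 / ((\<mu> + 1) (\<mu> + 2))\<close> this is Bessel's equation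
  \<open>w F'' = - (\<mu> + 1) F' - F\<close>.
\<close>
lemma bessel_entire_ode:
  assumes "\<mu> > -1"
  shows "w * (bessel_entire (\<mu> + 2) w / ((\<mu> + 1) * (\<mu> + 2)))
           = - (\<mu> + 1) * (- bessel_entire (\<mu> + 1) w / (\<mu> + 1)) - bessel_entire \<mu> w"
proof -
  have "- a * (- g / a) = g" if "a \<noteq> 0" for a g :: real using that by simp
  from this[of "\<mu> + 1"] show ?thesis
    using assms bessel_entire_contiguous[OF assms, of w] by simp
qed

text \<open>
  Consider the energy \<open>E = t F'\<^sup>2 + F\<^sup>2\<close>. The differential equation gives \<open>E' = - (2 \<mu> + 1) F'\<^sup>2\<close>, so
  \<open>t powr K * E t\<close> is nondecreasing for \<open>K = \<bar>2 \<mu> + 1\<bar>\<close>. At a multiple zero \<open>w\<close> the energy vanishes, hence it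
  vanishes on \<open>(0, w)\<close> as well, which contradicts \<open>F 0 = 1\<close>.
\<close>
lemma bessel_entire_zero_simple:
  assumes "\<mu> > -1" "w > 0" "bessel_entire \<mu> w = 0"
  shows "bessel_entire (\<mu> + 1) w \<noteq> 0"
proof
  assume 0: "bessel_entire (\<mu> + 1) w = 0"
  define F where "F = bessel_entire \<mu>"
  define F1 where "F1 t = - bessel_entire (\<mu> + 1) t / (\<mu> + 1)" for t
  define F2 where "F2 t = bessel_entire (\<mu> + 2) t / ((\<mu> + 1) * (\<mu> + 2))" for t
  define K where "K = \<bar>2 * \<mu> + 1\<bar>"
  define E where "E t = t * (F1 t)\<^sup>2 + (F t)\<^sup>2" for t
  have dF: "(F has_real_derivative F1 t) (at t)" for t
    unfolding F_def F1_def using DERIV_bessel_entire[OF assms(1)] .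
  have dF1: "(F1 has_real_derivative F2 t) (at t)" for t
    unfolding F1_def[abs_def] F2_def using assms(1)
    by (auto intro!: derivative_eq_intros DERIV_bessel_entire simp: add_ac)
  have ode: "t * F2 t = - (\<mu> + 1) * F1 t - F t" for t
    unfolding F2_def F1_def F_def by (rule bessel_entire_ode[OF assms(1)])
  have "t powr K * E t \<le> w powr K * E w" if t: "0 < t" "t < w" for t
  proof (rule DERIV_nonneg_imp_nondecreasing[of t w "\<lambda>t. t powr K * E t"])
    fix x assume x: "t \<le> x" "x \<le> w"
    hence x0: "x > 0" using t by simp
    let ?D = "K * x powr (K - 1) * E x + x powr K * ((F1 x)\<^sup>2 + 2 * (x * F2 x) * F1 x + 2 * F x * F1 x)"
    have "((\<lambda>t. t powr K * E t) has_real_derivative ?D) (at x)"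
      unfolding E_def using x0
      by (auto intro!: derivative_eq_intros has_real_derivative_powr dF dF1 simp: power2_eq_square algebra_simps)
    moreover have "?D \<ge> 0"
    proof -
      have "x powr K = x powr (K - 1) * x" using x0 powr_add[of x "K - 1" 1] by simp
      hence "?D = x powr (K - 1) * (K * E x - (2 * \<mu> + 1) * (x * (F1 x)\<^sup>2))"
        unfolding ode by (simp add: power2_eq_square algebra_simps)
      moreover have "(2 * \<mu> + 1) * (x * (F1 x)\<^sup>2) \<le> K * (x * (F1 x)\<^sup>2)"
        using x0 by (intro mult_right_mono) (auto simp: K_def)
      moreover have "K * E x = K * (x * (F1 x)\<^sup>2) + K * (F x)\<^sup>2" by (simp add: E_def distrib_left)
      moreover have "K * (F x)\<^sup>2 \<ge> 0" by (simp add: K_def)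
      ultimately show ?thesis by simp
    qed
    ultimately show "\<exists>y. ((\<lambda>t. t powr K * E t) has_real_derivative y) (at x) \<and> 0 \<le> y" by blast
  qed (use t in simp)
  moreover have "E w = 0" using 0 assms(3) by (simp add: E_def F1_def F_def)
  ultimately have le: "t powr K * E t \<le> 0" if "0 < t" "t < w" for t using that by simp
  have F0: "F t = 0" if t: "0 < t" "t < w" for t
  proof -
    have "E t \<le> 0" using le[OF t] t by (simp add: mult_le_0_iff)
    moreover have "t * (F1 t)\<^sup>2 \<ge> 0" using t by simp
    ultimately have "(F t)\<^sup>2 \<le> 0" unfolding E_def by linarith
    thus ?thesis by simp
  qed
  have "eventually (\<lambda>t. t \<in> {0<..<w}) (at_right 0)"
    using assms(2) by (rule eventually_at_right_real)
  hence "eventually (\<lambda>t. F t = 0) (at_right 0)" by eventually_elim (use F0 in auto)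
  hence "(F \<longlongrightarrow> 0) (at_right 0)" by (rule tendsto_eventually)
  moreover have "(F \<longlongrightarrow> F 0) (at_right 0)"
    using DERIV_isCont[OF dF, of 0] by (simp add: isCont_def filterlim_at_split)
  ultimately have "F 0 = 0" using tendsto_unique trivial_limit_at_right_real by blast
  thus False by (simp add: F_def bessel_entire_0)
qed

section \<open>Laguerre approximation and the sum over the zeros\<close>

definition laguerre_scaled :: "real \<Rightarrow> nat \<Rightarrow> real poly" where
  "laguerre_scaled \<mu> n = pcompose (laguerre_poly \<mu> n) [:0, 1 / real n:]"

lemma coeff_laguerre_scaled:
  "coeff (laguerre_scaled \<mu> n) m
     = (1 / real n) ^ m * real (n choose m) * ((- 1) ^ m / pochhammer (\<mu> + 1) m)"
  by (simp add: laguerre_scaled_def coeff_pcompose_linear coeff_laguerre_poly)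

lemma binomial_scaled_le: "(1 / real n) ^ m * real (n choose m) \<le> 1 / fact m"
proof (cases "n = 0")
  case False
  have "real (n choose m) * fact m \<le> real n ^ m"
    using binomial_fact_pow[of n m] by (metis of_nat_fact of_nat_le_iff of_nat_mult of_nat_power)
  thus ?thesis using False by (simp add: field_simps power_divide)
qed (cases m; simp)

lemma binomial_scaled_tendsto: "(\<lambda>n. (1 / real n) ^ m * real (n choose m)) \<longlonglongrightarrow> 1 / fact m"
proof (induction m)
  case (Suc m)
  have "(\<lambda>n. 1 - real m / real n) \<longlonglongrightarrow> 1 - 0"
    by (intro tendsto_diff tendsto_const lim_const_over_n)
  hence "(\<lambda>n. (1 / real n) ^ m * real (n choose m) * (1 - real m / real n) / (1 + real m))
      \<longlonglongrightarrow> 1 / fact m * (1 - 0) / (1 + real m)"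
    by (intro tendsto_intros Suc) auto
  also have "1 / fact m * (1 - 0) / (1 + real m) = 1 / (fact (Suc m) :: real)" by simp
  finally show ?case
  proof (rule Lim_transform_eventually)
    show "eventually (\<lambda>n. (1 / real n) ^ m * real (n choose m) * (1 - real m / real n) / (1 + real m)
        = (1 / real n) ^ Suc m * real (n choose Suc m)) sequentially"
      using eventually_gt_at_top[of 0]
    proof eventually_elim
      case (elim n)
      have "real (n choose Suc m) = (real n - real m) * real (n choose m) / (1 + real m)"
        using binomial_Suc_times[of m n] by (simp add: field_simps)
      moreover have "1 - real m / real n = (real n - real m) / real n" using elim by (simp add: field_simps)
      ultimately show ?case by (simp add: mult_ac)
    qed
  qed
qed simp

lemma abs_coeff_laguerre_scaled_le:
  assumes "\<mu> > -1"
  shows "\<bar>coeff (laguerre_scaled \<mu> n) m\<bar> \<le> \<bar>bessel_coeff \<mu> m\<bar>"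
proof -
  have p: "pochhammer (\<mu> + 1) m > 0" using assms by (simp add: pochhammer_pos)
  have "\<bar>coeff (laguerre_scaled \<mu> n) m\<bar> = (1 / real n) ^ m * real (n choose m) / pochhammer (\<mu> + 1) m"
    unfolding coeff_laguerre_scaled using p by (simp add: abs_mult power_abs)
  also have "\<dots> \<le> 1 / fact m / pochhammer (\<mu> + 1) m"
    using binomial_scaled_le p by (intro divide_right_mono) auto
  finally show ?thesis by (simp add: abs_bessel_coeff[OF assms])
qed

lemma coeff_laguerre_scaled_tendsto:
  "(\<lambda>n. coeff (laguerre_scaled \<mu> n) m) \<longlonglongrightarrow> bessel_coeff \<mu> m"
proof -
  have "(\<lambda>n. coeff (laguerre_scaled \<mu> n) m) \<longlonglongrightarrow> 1 / fact m * ((- 1) ^ m / pochhammer (\<mu> + 1) m)"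
    unfolding coeff_laguerre_scaled by (intro tendsto_mult binomial_scaled_tendsto tendsto_const)
  thus ?thesis by (simp add: bessel_coeff_def)
qed

lemma uniform_limit_laguerre_scaled:
  assumes "\<mu> > -1"
  shows "uniform_limit {0..M} (\<lambda>n. poly (laguerre_scaled \<mu> n)) (bessel_entire \<mu>) sequentially"
    and "uniform_limit {0..M} (\<lambda>n. poly (pderiv (laguerre_scaled \<mu> n)))
           (\<lambda>w. - bessel_entire (\<mu> + 1) w / (\<mu> + 1)) sequentially"
    and "uniform_limit {0..M} (\<lambda>n. poly (pderiv (pderiv (laguerre_scaled \<mu> n))))
           (\<lambda>w. bessel_entire (\<mu> + 2) w / ((\<mu> + 1) * (\<mu> + 2))) sequentially"
proof -
  have bnd: "\<bar>coeff (pderiv p) m\<bar> \<le> diffs g m" if "\<And>m. \<bar>coeff p m\<bar> \<le> g m" for p :: "real poly" and g m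
    using that[of "Suc m"] by (simp add: coeff_pderiv diffs_def abs_mult mult_left_mono)
  have lim: "(\<lambda>n. coeff (pderiv (p n)) m) \<longlonglongrightarrow> diffs c m" if "\<And>m. (\<lambda>n. coeff (p n) m) \<longlonglongrightarrow> c m"
    for p :: "nat \<Rightarrow> real poly" and c m
    unfolding coeff_pderiv diffs_def by (intro tendsto_intros that)
  note b0 = abs_coeff_laguerre_scaled_le[OF assms] 
  note l0 = coeff_laguerre_scaled_tendsto
  note s0 = summable_abs_bessel_coeff[OF assms]
  show "uniform_limit {0..M} (\<lambda>n. poly (laguerre_scaled \<mu> n)) (bessel_entire \<mu>) sequentially"
    unfolding bessel_entire_def[abs_def]
    by (rule uniform_limit_poly_dominated[OF b0 l0 s0])
  show "uniform_limit {0..M} (\<lambda>n. poly (pderiv (laguerre_scaled \<mu> n)))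
           (\<lambda>w. - bessel_entire (\<mu> + 1) w / (\<mu> + 1)) sequentially"
    unfolding suminf_diffs_bessel_coeff[OF assms, symmetric]
    by (rule uniform_limit_poly_dominated[OF bnd[OF b0] lim[OF l0] termdiff_converges_all[OF s0]])
  show "uniform_limit {0..M} (\<lambda>n. poly (pderiv (pderiv (laguerre_scaled \<mu> n))))
           (\<lambda>w. bessel_entire (\<mu> + 2) w / ((\<mu> + 1) * (\<mu> + 2))) sequentially"
    unfolding suminf_diffs_diffs_bessel_coeff[OF assms, symmetric]
    by (rule uniform_limit_poly_dominated[OF bnd[OF bnd[OF b0]] lim[OF lim[OF l0]]
          termdiff_converges_all[OF termdiff_converges_all[OF s0]]])
qed

text \<open>
  The sum of the reciprocal roots is read off from the linear coefficient: it equals \<open>1 / (\<mu> + 1)\<close> for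
  \<open>n \<ge> 1\<close>, and it is empty for \<open>n = 0\<close>.
\<close>
lemma laguerre_scaled_splits:
  assumes "\<mu> > -1"
  obtains A c where "finite A" "\<And>a. a \<in> A \<Longrightarrow> a > 0" "c \<noteq> 0"
    "laguerre_scaled \<mu> n = smult c (\<Prod>a\<in>A. [:- a, 1:])" "(\<Sum>a\<in>A. 1 / a) \<le> 1 / (\<mu> + 1)"
proof -
  have c0: "coeff (laguerre_scaled \<mu> n) 0 = 1" by (simp add: coeff_laguerre_scaled)
  obtain A c where A: "finite A" "\<And>a. a \<in> A \<Longrightarrow> a > 0" "c \<noteq> 0"
    "laguerre_scaled \<mu> n = smult c (\<Prod>a\<in>A. [:- a, 1:])"
  proof (cases "n = 0")
    case True
    have "laguerre_scaled \<mu> n = 1" using True by (intro poly_eqI) (auto simp: coeff_laguerre_scaled binomial_eq_0_iff coeff_1)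
    thus ?thesis by (intro that[of "{}" 1]) auto
  next
    case False
    obtain R where R: "finite R" "card R = n" "\<And>a. a \<in> R \<Longrightarrow> a > 0 \<and> poly (laguerre_poly \<mu> n) a = 0"
      using laguerre_roots[OF assms] by blast
    define A where "A = (\<lambda>a. real n * a) ` R"
    have cardA: "card A = n" unfolding A_def using False R(2) by (subst card_image) (auto simp: inj_on_def)
    have deg: "degree (laguerre_scaled \<mu> n) = n"
      using False by (simp add: laguerre_scaled_def degree_pcompose degree_laguerre_poly[OF assms])
    have rt: "poly (laguerre_scaled \<mu> n) a = 0" if "a \<in> A" for a
      using that R(3) False by (auto simp: A_def laguerre_scaled_def poly_pcompose)
    have nz: "laguerre_scaled \<mu> n \<noteq> 0" using c0 by auto
    have "finite A" using R(1) by (simp add: A_def)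
    from split_by_roots[OF this _ nz rt] cardA deg
    obtain c where "c \<noteq> 0" "laguerre_scaled \<mu> n = smult c (\<Prod>a\<in>A. [:- a, 1:])" by metis
    thus ?thesis using R False by (intro that[of A c]) (auto simp: A_def)
  qed
  let ?q = "\<Prod>a\<in>A. [:- a, 1:]"
  have "poly (pderiv ?q) 0 = - poly ?q 0 * (\<Sum>a\<in>A. 1 / a)"
    using A by (intro log_deriv_at_0_prod) auto
  hence "poly (pderiv (laguerre_scaled \<mu> n)) 0 = - poly (laguerre_scaled \<mu> n) 0 * (\<Sum>a\<in>A. 1 / a)"
    unfolding A(4) by (simp add: pderiv_smult)
  hence "(\<Sum>a\<in>A. 1 / a) = - coeff (laguerre_scaled \<mu> n) 1"
    by (simp add: poly_0_coeff_0 coeff_pderiv c0)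
  also have "\<dots> \<le> 1 / (\<mu> + 1)" using assms by (simp add: coeff_laguerre_scaled)
  finally show ?thesis using A that by blast
qed

theorem bessel_entire_sum_over_zeros:
  assumes "\<mu> > -1" "w \<ge> 0" "bessel_entire \<mu> w \<noteq> 0"
  shows "((\<lambda>z. 1 / (w - z)\<^sup>2) has_sum
      ((- bessel_entire (\<mu> + 1) w / (\<mu> + 1))\<^sup>2
          - bessel_entire \<mu> w * (bessel_entire (\<mu> + 2) w / ((\<mu> + 1) * (\<mu> + 2)))) / (bessel_entire \<mu> w)\<^sup>2)
      {z. z > 0 \<and> bessel_entire \<mu> z = 0}"
proof -
  have "\<exists>A c. finite A \<and> (\<forall>a\<in>A. a > 0) \<and> c \<noteq> 0 \<and>
    laguerre_scaled \<mu> n = smult c (\<Prod>a\<in>A. [:- a, 1:]) \<and> (\<Sum>a\<in>A. 1 / a) \<le> 1 / (\<mu> + 1)" for n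
    using laguerre_scaled_splits[OF assms(1), of n] by metis
  then obtain A c where A: "\<And>n. finite (A n)" "\<And>n a. a \<in> A n \<Longrightarrow> a > 0" "\<And>n. c n \<noteq> 0"
    "\<And>n. laguerre_scaled \<mu> n = smult (c n) (\<Prod>a\<in>A n. [:- a, 1:])" "\<And>n. (\<Sum>a\<in>A n. 1 / a) \<le> 1 / (\<mu> + 1)"
    by metis
  show ?thesis
  proof (rule has_sum_inverse_squares_of_zeros[OF A(1,2,4,3,5) uniform_limit_laguerre_scaled(1,2)[OF assms(1)] _
      DERIV_bessel_entire[OF assms(1)]])
    show "(\<lambda>n. poly (pderiv (pderiv (laguerre_scaled \<mu> n))) w) \<longlonglongrightarrow> bessel_entire (\<mu> + 2) w / ((\<mu> + 1) * (\<mu> + 2))"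
      using tendsto_uniform_limitI[OF uniform_limit_laguerre_scaled(3)[OF assms(1), of w], of w] assms(2) by simp
    show "isCont (\<lambda>w. - bessel_entire (\<mu> + 1) w / (\<mu> + 1)) x" for x
      using assms(1) by (intro continuous_intros isCont_bessel_entire) auto
    show "- bessel_entire (\<mu> + 1) x / (\<mu> + 1) \<noteq> 0" if "x > 0" "bessel_entire \<mu> x = 0" for x
      using bessel_entire_zero_simple[OF assms(1) that] assms(1) by simp
  qed (use assms in \<open>simp_all add: bessel_entire_0\<close>)
qed

section \<open>Existence of infinitely many zeros\<close>

lemma bessel_entire_zeros_finite:
  assumes "\<mu> > -1"
  shows "finite {z \<in> {0..M}. bessel_entire \<mu> z = 0}"
proof (rule simple_zeros_finite[OF DERIV_bessel_entire[OF assms]])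
  fix x assume x: "x \<in> {0..M}" "bessel_entire \<mu> x = 0"
  hence "x > 0" using bessel_entire_0[of \<mu>] by (cases "x = 0") auto
  thus "- bessel_entire (\<mu> + 1) x / (\<mu> + 1) \<noteq> 0"
    using bessel_entire_zero_simple[OF assms _ x(2)] assms by simp
qed

text \<open>
  Suppose that the set \<open>Z\<close> of zeros is finite. To the right of \<open>Z\<close> the expansion of the derivative of
  \<open>h = F'/F\<close> integrates to \<open>h t = \<kappa> + (\<Sum>z\<in>Z. 1 / (t - z))\<close>, while the differential equation becomes
  the Riccati equation \<open>t h\<^sup>2 - t S + (\<mu> + 1) h + 1 = 0\<close> with \<open>S = (\<Sum>z\<in>Z. 1 / (t - z)\<^sup>2)\<close>. As \<open>t\<close> tends to
  infinity, dividing by \<open>t\<close> shows \<open>\<kappa> = 0\<close>, and then every term but the last tends to 0.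
\<close>
lemma bessel_entire_infinite_zeros:
  assumes "\<mu> > -1"
  shows "infinite {z. z > 0 \<and> bessel_entire \<mu> z = 0}"
proof
  define Z where "Z = {z. z > 0 \<and> bessel_entire \<mu> z = 0}"
  assume "finite {z. z > 0 \<and> bessel_entire \<mu> z = 0}"
  hence finZ: "finite Z" by (simp add: Z_def)
  define a where "a = Max (insert 0 Z)"
  have aZ: "z \<le> a" if "z \<in> Z" for z using finZ that by (simp add: a_def)
  have a0: "a \<ge> 0" using finZ by (simp add: a_def)
  define F where "F = bessel_entire \<mu>"
  define F1 where "F1 t = - bessel_entire (\<mu> + 1) t / (\<mu> + 1)" for t
  define F2 where "F2 t = bessel_entire (\<mu> + 2) t / ((\<mu> + 1) * (\<mu> + 2))" for t
  define h where "h t = F1 t / F t" for t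
  define u where "u t = (\<Sum>z\<in>Z. 1 / (t - z))" for t
  define S where "S t = (\<Sum>z\<in>Z. 1 / (t - z)\<^sup>2)" for t
  have dF: "(F has_real_derivative F1 t) (at t)" for t
    unfolding F_def F1_def using DERIV_bessel_entire[OF assms(1)] .
  have dF1: "(F1 has_real_derivative F2 t) (at t)" for t
    unfolding F1_def[abs_def] F2_def using assms(1)
    by (auto intro!: derivative_eq_intros DERIV_bessel_entire simp: add_ac)
  have ode: "t * F2 t = - (\<mu> + 1) * F1 t - F t" for t
    unfolding F2_def F1_def F_def by (rule bessel_entire_ode[OF assms(1)])
  have Fnz: "F t \<noteq> 0" if "t > a" for t
    using aZ[of t] that a0 by (auto simp: Z_def F_def)
  have S: "S t = ((F1 t)\<^sup>2 - F t * F2 t) / (F t)\<^sup>2" if t: "t > a" for t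
    using bessel_entire_sum_over_zeros[OF assms, of t] Fnz[OF t] t a0 finZ
    by (simp add: has_sum_finite_iff Z_def[symmetric] S_def F_def F1_def F2_def)
  have dh: "(h has_real_derivative - S t) (at t)" if t: "t > a" for t
  proof -
    have "(h has_real_derivative (F2 t * F t - F1 t * F1 t) / (F t * F t)) (at t)"
      unfolding h_def[abs_def] by (rule DERIV_divide[OF dF1 dF Fnz[OF t]])
    also have "(F2 t * F t - F1 t * F1 t) / (F t * F t) = - S t"
      unfolding S[OF t] by (simp add: power2_eq_square minus_divide_left mult.commute)
    finally show ?thesis .
  qed
  have du: "(u has_real_derivative - S t) (at t)" if t: "t > a" for t
  proof -
    have "((\<lambda>t. 1 / (t - z)) has_real_derivative - (1 / (t - z)\<^sup>2)) (at t)" if "z \<in> Z" for z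
      using aZ[OF that] t by (auto intro!: derivative_eq_intros simp: power2_eq_square)
    hence "((\<lambda>t. \<Sum>z\<in>Z. 1 / (t - z)) has_real_derivative (\<Sum>z\<in>Z. - (1 / (t - z)\<^sup>2))) (at t)"
      by (intro DERIV_sum)
    thus ?thesis by (simp add: u_def[abs_def] S_def sum_negf)
  qed
  have "\<exists>\<kappa>. \<forall>t\<in>{a<..}. h t - u t = \<kappa>"
  proof (rule has_field_derivative_zero_constant)
    fix t assume "t \<in> {a<..}"
    thus "((\<lambda>t. h t - u t) has_real_derivative 0) (at t within {a<..})"
      using DERIV_diff[OF dh du, of t] by (auto intro: has_field_derivative_at_within)
  qed simp
  then obtain \<kappa> where \<kappa>: "\<And>t. t > a \<Longrightarrow> h t = u t + \<kappa>" by (auto simp: algebra_simps)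
  have riccati: "t * (h t)\<^sup>2 - t * S t + (\<mu> + 1) * h t + 1 = 0" if t: "t > a" for t
  proof -
    have "S t = (h t)\<^sup>2 - F2 t / F t"
      unfolding S[OF t] h_def using Fnz[OF t] by (simp add: power_divide diff_divide_distrib power2_eq_square)
    hence "t * (h t)\<^sup>2 - t * S t = (t * F2 t) / F t" by (simp add: right_diff_distrib)
    also have "\<dots> = - (\<mu> + 1) * h t - 1"
      unfolding ode h_def using Fnz[OF t] by (simp add: diff_divide_distrib)
    finally show ?thesis by (simp add: algebra_simps)
  qed

  have inv: "((\<lambda>t. 1 / (t - z)) \<longlongrightarrow> 0) at_top" for z :: real
  proof -
    have "filterlim (\<lambda>t. - z + t) at_top at_top"
      by (rule filterlim_tendsto_add_at_top[OF tendsto_const filterlim_ident])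
    hence "((\<lambda>t. inverse (- z + t)) \<longlongrightarrow> 0) at_top" by (rule tendsto_inverse_0_at_top)
    thus ?thesis by (simp add: inverse_eq_divide)
  qed
  have tinv: "((\<lambda>t. t * (1 / (t - z))) \<longlongrightarrow> 1) at_top" for z :: real
  proof -
    have "((\<lambda>t. 1 + z * (1 / (t - z))) \<longlongrightarrow> 1 + z * 0) at_top" by (intro tendsto_intros inv)
    hence "((\<lambda>t. 1 + z * (1 / (t - z))) \<longlongrightarrow> 1) at_top" by simp
    thus ?thesis
      by (rule Lim_transform_eventually)
         (use eventually_gt_at_top[of z] in eventually_elim, simp add: field_simps)
  qed
  have u0: "(u \<longlongrightarrow> 0) at_top"
    unfolding u_def[abs_def] using tendsto_sum[of Z "\<lambda>z t. 1 / (t - z)" "\<lambda>_. 0" at_top] inv by simp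
  have tu: "((\<lambda>t. t * u t) \<longlongrightarrow> real (card Z)) at_top"
    unfolding u_def sum_distrib_left
    using tendsto_sum[of Z "\<lambda>z t. t * (1 / (t - z))" "\<lambda>_. 1" at_top] tinv by simp
  have tS: "((\<lambda>t. t * S t) \<longlongrightarrow> 0) at_top"
  proof -
    have "((\<lambda>t. \<Sum>z\<in>Z. (t * (1 / (t - z))) * (1 / (t - z))) \<longlongrightarrow> (\<Sum>z\<in>Z. 1 * 0)) at_top"
      by (intro tendsto_sum tendsto_mult inv tinv)
    thus ?thesis by (simp add: S_def sum_distrib_left power2_eq_square)
  qed
  have evh: "eventually (\<lambda>t. u t + \<kappa> = h t) at_top"
    using eventually_gt_at_top[of a] by eventually_elim (simp add: \<kappa>)
  have "((\<lambda>t. u t + \<kappa>) \<longlongrightarrow> 0 + \<kappa>) at_top" by (intro tendsto_intros u0)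
  hence hk: "(h \<longlongrightarrow> \<kappa>) at_top" using evh by (simp add: Lim_transform_eventually)
  have "\<kappa> = 0"
  proof -
    have i: "((\<lambda>t :: real. 1 / t) \<longlongrightarrow> 0) at_top" using inv[of 0] by simp
    have "((\<lambda>t. (1 / t) * (t * S t - (\<mu> + 1) * h t - 1)) \<longlongrightarrow> 0 * (0 - (\<mu> + 1) * \<kappa> - 1)) at_top"
      by (intro tendsto_intros i tS hk)
    moreover have "eventually (\<lambda>t. (1 / t) * (t * S t - (\<mu> + 1) * h t - 1) = (h t)\<^sup>2) at_top"
      using eventually_gt_at_top[of a]
    proof eventually_elim
      case (elim t)
      have "t * S t - (\<mu> + 1) * h t - 1 = t * (h t)\<^sup>2" using riccati[OF elim] by simp
      thus ?case using elim a0 by simp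
    qed
    ultimately have "((\<lambda>t. (h t)\<^sup>2) \<longlongrightarrow> 0) at_top" by (simp add: Lim_transform_eventually)
    moreover have "((\<lambda>t. (h t)\<^sup>2) \<longlongrightarrow> \<kappa>\<^sup>2) at_top" by (intro tendsto_intros hk)
    ultimately have "\<kappa>\<^sup>2 = 0" by (intro tendsto_unique[OF trivial_limit_at_top_linorder])
    thus ?thesis by simp
  qed
  have "((\<lambda>t. (t * u t) * u t - t * S t + (\<mu> + 1) * u t + 1) \<longlongrightarrow> real (card Z) * 0 - 0 + (\<mu> + 1) * 0 + 1) at_top"
    by (intro tendsto_intros tu tS u0)
  hence "((\<lambda>t. (t * u t) * u t - t * S t + (\<mu> + 1) * u t + 1) \<longlongrightarrow> 1) at_top" by simp
  moreover have "eventually (\<lambda>t. (t * u t) * u t - t * S t + (\<mu> + 1) * u t + 1 = 0) at_top"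
    using eventually_gt_at_top[of a]
    by eventually_elim (use riccati \<kappa> \<open>\<kappa> = 0\<close> in \<open>simp add: power2_eq_square mult.assoc\<close>)
  ultimately have "((\<lambda>t::real. 0 :: real) \<longlongrightarrow> 1) at_top" by (rule Lim_transform_eventually)
  hence "(0 :: real) = 1"
    by (intro tendsto_unique[OF trivial_limit_at_top_linorder tendsto_const, of "0 :: real" 1])
  thus False by simp
qed

section \<open>Bessel functions and their derivatives\<close>

lemma bessel_J_conv_entire:
  assumes "\<mu> > -1" "x > 0"
  shows "bessel_J \<mu> x = (x / 2) powr \<mu> / Gamma (\<mu> + 1) * bessel_entire \<mu> (x\<^sup>2 / 4)"
proof -
  have "\<mu> + 1 \<notin> \<int>\<^sub>\<le>\<^sub>0" using assms by (auto elim!: nonpos_Ints_cases)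
  moreover have "Gamma (\<mu> + 1) > 0" using assms by (intro Gamma_real_pos) simp
  ultimately have G: "Gamma (real m + \<mu> + 1) = Gamma (\<mu> + 1) * pochhammer (\<mu> + 1) m" for m
    using pochhammer_Gamma[of "\<mu> + 1" m] by (simp add: add_ac)
  have P: "(x / 2) powr (2 * real m + \<mu>) = (x / 2) powr \<mu> * (x\<^sup>2 / 4) ^ m" for m
  proof -
    have "(x / 2) powr (2 * real m) = (x / 2) ^ (2 * m)"
      using assms powr_realpow[of "x / 2" "2 * m"] by simp
    also have "\<dots> = (x\<^sup>2 / 4) ^ m" by (simp add: power_mult power_divide)
    finally show ?thesis by (simp add: powr_add)
  qed
  have "bessel_J \<mu> x = (\<Sum>m. (x / 2) powr \<mu> / Gamma (\<mu> + 1) * (bessel_coeff \<mu> m * (x\<^sup>2 / 4) ^ m))"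
    unfolding bessel_J_def G P bessel_coeff_def by (simp add: mult_ac)
  also have "\<dots> = (x / 2) powr \<mu> / Gamma (\<mu> + 1) * bessel_entire \<mu> (x\<^sup>2 / 4)"
    unfolding bessel_entire_def by (rule suminf_mult[OF summable_bessel_coeff[OF assms(1)]])
  finally show ?thesis .
qed

lemma bessel_J_eq_0_iff:
  assumes "\<mu> > -1" "x > 0"
  shows "bessel_J \<mu> x = 0 \<longleftrightarrow> bessel_entire \<mu> (x\<^sup>2 / 4) = 0"
proof -
  have "Gamma (\<mu> + 1) > 0" using assms(1) by (intro Gamma_real_pos) simp
  hence "Gamma (\<mu> + 1) \<noteq> 0" by simp
  thus ?thesis using bessel_J_conv_entire[OF assms] assms by simp
qed

text \<open>
  The Euler operator \<open>x d/dx\<close> applied to \<open>J\<^sub>\<nu>\<close>, with the factor \<open>(x / 2)\<^sup>\<nu> / \<Gamma>(\<nu> + 1)\<close> removed and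
  written in the variable \<open>w = x\<^sup>2 / 4\<close>; in terms of \<open>F\<^sub>\<nu>\<close> it is \<open>\<nu> F\<^sub>\<nu> + 2 w F\<^sub>\<nu>'\<close>.
\<close>
definition bessel_euler :: "real \<Rightarrow> real \<Rightarrow> real" where
  "bessel_euler \<nu> w = \<nu> * bessel_entire \<nu> w - 2 * w * bessel_entire (\<nu> + 1) w / (\<nu> + 1)"

lemma DERIV_bessel_J:
  assumes "\<nu> > -1" "x > 0"
  shows "(bessel_J \<nu> has_real_derivative
           (x / 2) powr \<nu> / Gamma (\<nu> + 1) / x * bessel_euler \<nu> (x\<^sup>2 / 4)) (at x)"
proof -
  let ?F = "bessel_entire \<nu> (x\<^sup>2 / 4)" and ?G = "bessel_entire (\<nu> + 1) (x\<^sup>2 / 4)"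
  define C where "C = 1 / Gamma (\<nu> + 1)"
  have dF: "((\<lambda>x. bessel_entire \<nu> (x\<^sup>2 / 4)) has_real_derivative - ?G / (\<nu> + 1) * (x / 2)) (at x)"
    by (rule DERIV_chain2[OF DERIV_bessel_entire[OF assms(1)]])
       (auto intro!: derivative_eq_intros)
  have dP: "((\<lambda>x. (x / 2) powr \<nu>) has_real_derivative (\<nu> * (x / 2) powr (\<nu> - 1)) * (1 / 2)) (at x)"
    by (rule DERIV_chain2[OF has_real_derivative_powr])
       (use assms in \<open>auto intro!: derivative_eq_intros\<close>)
  have "((\<lambda>x. C * ((x / 2) powr \<nu> * bessel_entire \<nu> (x\<^sup>2 / 4))) has_real_derivative
      C * ((\<nu> * (x / 2) powr (\<nu> - 1)) * (1 / 2) * ?F + - ?G / (\<nu> + 1) * (x / 2) * (x / 2) powr \<nu>)) (at x)"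
    by (intro DERIV_cmult DERIV_mult dF dP)
  also have "C * ((\<nu> * (x / 2) powr (\<nu> - 1)) * (1 / 2) * ?F + - ?G / (\<nu> + 1) * (x / 2) * (x / 2) powr \<nu>)
      = (x / 2) powr \<nu> / Gamma (\<nu> + 1) / x * bessel_euler \<nu> (x\<^sup>2 / 4)"
  proof -
    have p: "(x / 2) powr (\<nu> - 1) = (x / 2) powr \<nu> / (x / 2)" using assms by (simp add: powr_diff)
    have "C * ((\<nu> * (p / (x / 2))) * (1 / 2) * F + - G / (\<nu> + 1) * (x / 2) * p)
       = p * C / x * (\<nu> * F - 2 * (x\<^sup>2 / 4) * G / (\<nu> + 1))" for p F G :: real
      using assms by (simp add: divide_simps power2_eq_square) (simp add: algebra_simps)
    thus ?thesis unfolding p bessel_euler_def C_def by simp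
  qed
  finally show ?thesis
  proof (rule DERIV_cong_ev[THEN iffD1, rotated -1])
    have "eventually (\<lambda>y. y > 0) (nhds x)" using assms eventually_nhds_in_open[of "{0<..}" x] by simp
    thus "eventually (\<lambda>y. C * ((y / 2) powr \<nu> * bessel_entire \<nu> (y\<^sup>2 / 4)) = bessel_J \<nu> y) (nhds x)"
      by eventually_elim (simp add: bessel_J_conv_entire[OF assms(1)] C_def)
  qed auto
qed

lemma deriv_bessel_J_eq_0_iff:
  assumes "\<nu> > -1" "x > 0"
  shows "deriv (bessel_J \<nu>) x = 0 \<longleftrightarrow> bessel_euler \<nu> (x\<^sup>2 / 4) = 0"
proof -
  have "Gamma (\<nu> + 1) > 0" using assms(1) by (intro Gamma_real_pos) simp
  hence "Gamma (\<nu> + 1) \<noteq> 0" by simp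
  thus ?thesis using DERIV_imp_deriv[OF DERIV_bessel_J[OF assms]] assms by simp
qed

section \<open>The sum at a critical point\<close>

text \<open>
  With \<open>G = F\<^sub>\<nu>\<^sub>+\<^sub>1\<close> the critical equation reads \<open>F\<^sub>\<nu> / G = 2 w / (\<nu> (\<nu> + 1))\<close>. Two contiguous relations
  turn this into \<open>G'/G = - q\<close> and \<open>G''/G = ((\<nu> + 2) q - 1) / w\<close> for \<open>q = (\<nu> + 1) / w - 2 / \<nu>\<close>.
\<close>
lemma bessel_sum_at_critical:
  assumes "\<nu> > -1" "\<nu> \<noteq> 0" "w > 0" and crit: "bessel_euler \<nu> w = 0"
  shows "((\<lambda>z. 1 / (w - z)\<^sup>2) has_sum (4 / \<nu>\<^sup>2 - 1 / w - (\<nu> + 1) / w\<^sup>2))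
           {z. z > 0 \<and> bessel_entire (\<nu> + 1) z = 0}"
proof -
  define F where "F = bessel_entire \<nu> w"
  define G where "G = bessel_entire (\<nu> + 1) w"
  define H where "H = bessel_entire (\<nu> + 2) w"
  define I where "I = bessel_entire (\<nu> + 3) w"
  define q where "q = (\<nu> + 1) / w - 2 / \<nu>"
  have nz: "\<nu> + 1 \<noteq> 0" "\<nu> + 2 \<noteq> 0" "\<nu> + 3 \<noteq> 0" "w \<noteq> 0" using assms by auto
  have e: "\<nu> * F = 2 * w * G / (\<nu> + 1)" using crit by (simp add: bessel_euler_def F_def G_def)
  have c1: "w * (H / ((\<nu> + 1) * (\<nu> + 2))) = G - F"
    using bessel_entire_contiguous[OF assms(1), of w] by (simp add: F_def G_def H_def)
  have c2: "w * (I / ((\<nu> + 2) * (\<nu> + 3))) = H - G"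
    using bessel_entire_contiguous[of "\<nu> + 1" w] assms(1) by (simp add: I_def G_def H_def add_ac)
  have G0: "G \<noteq> 0"
  proof
    assume G: "G = 0"
    hence "F = 0" using e assms(2) by simp
    thus False using bessel_entire_zero_simple[OF assms(1,3)] G by (simp add: F_def G_def)
  qed
  have FG: "F = 2 * w * G / (\<nu> * (\<nu> + 1))"
  proof -
    have "F = \<nu> * F / \<nu>" using assms(2) by simp
    thus ?thesis unfolding e by (simp add: mult.commute)
  qed
  have H: "H / (\<nu> + 2) = q * G"
  proof -
    have "H / (\<nu> + 2) = (\<nu> + 1) / w * (w * (H / ((\<nu> + 1) * (\<nu> + 2))))" using nz by simp
    also have "\<dots> = (\<nu> + 1) / w * (G - F)" unfolding c1 ..
    also have "\<dots> = q * G" unfolding FG q_def using nz assms(2) by (simp add: divide_simps) (simp add: algebra_simps)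
    finally show ?thesis .
  qed
  have H': "H = (\<nu> + 2) * q * G" using H nz(2) by (simp add: field_simps)
  have I: "I / ((\<nu> + 2) * (\<nu> + 3)) = ((\<nu> + 2) * q - 1) / w * G"
  proof -
    have "I / ((\<nu> + 2) * (\<nu> + 3)) = (H - G) / w" unfolding c2[symmetric] using nz by simp
    also have "\<dots> = ((\<nu> + 2) * q - 1) / w * G" unfolding H' by (simp add: algebra_simps)
    finally show ?thesis .
  qed
  have "((- H / (\<nu> + 2))\<^sup>2 - G * (I / ((\<nu> + 2) * (\<nu> + 3)))) / G\<^sup>2
      = q\<^sup>2 - ((\<nu> + 2) * q - 1) / w"
  proof -
    have gen: "(q * G)\<^sup>2 - G * (r * G) = (q\<^sup>2 - r) * G\<^sup>2" for r
      by (simp add: power2_eq_square algebra_simps)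
    have "(- H / (\<nu> + 2))\<^sup>2 = (q * G)\<^sup>2" using H by simp
    hence "(- H / (\<nu> + 2))\<^sup>2 - G * (I / ((\<nu> + 2) * (\<nu> + 3))) = (q\<^sup>2 - ((\<nu> + 2) * q - 1) / w) * G\<^sup>2"
      unfolding I by (simp only: gen)
    thus ?thesis using G0 by simp
  qed
  also have "\<dots> = 4 / \<nu>\<^sup>2 - 1 / w - (\<nu> + 1) / w\<^sup>2"
    unfolding q_def using assms(2) nz(4)
    by (simp add: divide_simps power2_eq_square) (simp add: algebra_simps)
  finally have val: "((- H / (\<nu> + 2))\<^sup>2 - G * (I / ((\<nu> + 2) * (\<nu> + 3)))) / G\<^sup>2
      = 4 / \<nu>\<^sup>2 - 1 / w - (\<nu> + 1) / w\<^sup>2" .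
  have shift: "\<nu> + 1 + 1 = \<nu> + 2" "\<nu> + 1 + 2 = \<nu> + 3" by simp_all
  have "\<nu> + 1 > - 1" "w \<ge> 0" "bessel_entire (\<nu> + 1) w \<noteq> 0"
    using assms G0 by (simp_all add: G_def)
  from bessel_entire_sum_over_zeros[OF this] show ?thesis
    unfolding shift G_def[symmetric] H_def[symmetric] I_def[symmetric] val .
qed

text \<open>
  A negative closed form cannot be a sum of squares. The bound says that \<open>x\<^sup>2 > \<nu>\<^sup>2\<close> at a critical
  point \<open>x\<close> of \<open>J\<^sub>\<nu>\<close>, in particular for \<open>-1 < \<nu> < 0\<close>.
\<close>
lemma bessel_critical_beyond:
  assumes "\<nu> > -1" "\<nu> \<noteq> 0" "w > 0" "bessel_euler \<nu> w = 0"
  shows "\<nu>\<^sup>2 < 4 * w"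
proof -
  have "0 \<le> 4 / \<nu>\<^sup>2 - 1 / w - (\<nu> + 1) / w\<^sup>2"
    by (rule has_sum_nonneg[OF bessel_sum_at_critical[OF assms]]) simp
  moreover have "(\<nu> + 1) / w\<^sup>2 > 0" using assms by simp
  ultimately have "1 / w < 4 / \<nu>\<^sup>2" by linarith
  thus ?thesis using assms by (simp add: field_simps)
qed

lemma DERIV_bessel_euler:
  assumes "\<nu> > -1"
  shows "(bessel_euler \<nu> has_real_derivative
           \<nu> * bessel_entire (\<nu> + 1) w / (\<nu> + 1) - 2 * bessel_entire \<nu> w) (at w)"
proof -
  define F where "F = bessel_entire \<nu> w"
  define G where "G = bessel_entire (\<nu> + 1) w"
  define H where "H = bessel_entire (\<nu> + 2) w"
  have nz: "\<nu> + 1 \<noteq> 0" "\<nu> + 2 \<noteq> 0" using assms by auto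
  have dF: "(bessel_entire \<nu> has_real_derivative - G / (\<nu> + 1)) (at w)"
    unfolding G_def by (rule DERIV_bessel_entire[OF assms])
  have dG: "(bessel_entire (\<nu> + 1) has_real_derivative - H / (\<nu> + 2)) (at w)"
    using DERIV_bessel_entire[of "\<nu> + 1" w] assms by (simp add: H_def add_ac)
  have c1: "w * (H / ((\<nu> + 1) * (\<nu> + 2))) = G - F"
    using bessel_entire_contiguous[OF assms(1), of w] by (simp add: F_def G_def H_def)
  have "((\<lambda>w. \<nu> * bessel_entire \<nu> w - 2 * w * bessel_entire (\<nu> + 1) w / (\<nu> + 1)) has_real_derivative
      (\<nu> * (- G / (\<nu> + 1)) - (2 * G + (- H / (\<nu> + 2)) * (2 * w)) / (\<nu> + 1))) (at w)"
    using nz by (auto intro!: derivative_eq_intros dF dG simp: G_def)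
  also have "\<nu> * (- G / (\<nu> + 1)) - (2 * G + (- H / (\<nu> + 2)) * (2 * w)) / (\<nu> + 1)
      = - (\<nu> + 2) * G / (\<nu> + 1) + 2 * (w * (H / ((\<nu> + 1) * (\<nu> + 2))))"
    using nz by (simp add: divide_simps) (simp add: algebra_simps)
  also have "\<dots> = \<nu> * G / (\<nu> + 1) - 2 * F"
    unfolding c1 using nz by (simp add: divide_simps) (simp add: algebra_simps)
  finally show ?thesis unfolding bessel_euler_def[abs_def] F_def G_def .
qed

text \<open>
  At a zero the derivative is \<open>(\<nu>\<^sup>2 / (2 w) - 2) F\<^sub>\<nu>\<close>, where \<open>F\<^sub>\<nu> \<noteq> 0\<close> because a
  common zero with \<open>F\<^sub>\<nu>'\<close> is impossible. So it could vanish only for \<open>4 w = \<nu>\<^sup>2\<close>, which is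
  excluded by \<open>bessel_critical_beyond\<close>.
\<close>
lemma bessel_euler_zeros_finite:
  assumes "\<nu> > -1" "\<nu> \<noteq> 0"
  shows "finite {w \<in> {0..M}. bessel_euler \<nu> w = 0}"
proof (rule simple_zeros_finite[OF DERIV_bessel_euler[OF assms(1)]])
  fix w assume w: "w \<in> {0..M}" "bessel_euler \<nu> w = 0"
  have w0: "w > 0" using w assms(2) by (cases "w = 0") (auto simp: bessel_euler_def bessel_entire_0)
  define F where "F = bessel_entire \<nu> w"
  define g where "g = bessel_entire (\<nu> + 1) w / (\<nu> + 1)"
  have e: "\<nu> * F = 2 * w * g" using w(2) by (simp add: bessel_euler_def F_def g_def)
  have F0: "F \<noteq> 0"
  proof
    assume F: "F = 0"
    hence "g = 0" using e w0 by simp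
    thus False using bessel_entire_zero_simple[OF assms(1) w0] F assms(1) by (simp add: F_def g_def)
  qed
  have "2 * w * (\<nu> * g - 2 * F) = (\<nu>\<^sup>2 - 4 * w) * F"
    using e by (simp add: power2_eq_square algebra_simps)
  moreover have "\<nu>\<^sup>2 - 4 * w \<noteq> 0" using bessel_critical_beyond[OF assms w0 w(2)] by simp
  ultimately have "\<nu> * g - 2 * F \<noteq> 0" using F0 by auto
  thus "\<nu> * bessel_entire (\<nu> + 1) w / (\<nu> + 1) - 2 * bessel_entire \<nu> w \<noteq> 0"
    by (simp add: F_def g_def)
qed

section \<open>Passage to the enumerated zeros\<close>

lemma finite_via_quarter_square:
  assumes "\<And>M. finite {w \<in> {0..M}. P w}"
  shows "finite ({x. x > 0 \<and> P (x\<^sup>2 / 4)} \<inter> {..M :: real})"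
proof (rule finite_imageD)
  show "finite ((\<lambda>x. x\<^sup>2 / 4) ` ({x. x > 0 \<and> P (x\<^sup>2 / 4)} \<inter> {..M}))"
  proof (rule finite_subset[OF _ assms[of "M\<^sup>2 / 4"]])
    show "(\<lambda>x. x\<^sup>2 / 4) ` ({x. x > 0 \<and> P (x\<^sup>2 / 4)} \<inter> {..M}) \<subseteq> {w \<in> {0..M\<^sup>2 / 4}. P w}"
      by (auto intro!: power_mono)
  qed
  show "inj_on (\<lambda>x. x\<^sup>2 / 4) ({x. x > 0 \<and> P (x\<^sup>2 / 4)} \<inter> {..M})"
    by (rule inj_onI) (auto simp: power2_eq_iff)
qed

lemma bij_betw_quarter_square:
  "bij_betw (\<lambda>x :: real. x\<^sup>2 / 4) {x. x > 0 \<and> P (x\<^sup>2 / 4)} {w. w > 0 \<and> P w}"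
proof (rule bij_betw_byWitness[of _ "\<lambda>w. 2 * sqrt w"])
  show "(\<lambda>w. 2 * sqrt w) ` {w. w > 0 \<and> P w} \<subseteq> {x. x > 0 \<and> P (x\<^sup>2 / 4)}"
    by (auto simp: power_mult_distrib)
  show "\<forall>x\<in>{x. x > 0 \<and> P (x\<^sup>2 / 4)}. 2 * sqrt (x\<^sup>2 / 4) = x"
    by (simp add: real_sqrt_divide)
  show "\<forall>w\<in>{w. w > 0 \<and> P w}. (2 * sqrt w)\<^sup>2 / 4 = w"
    by (simp add: power_mult_distrib)
  show "(\<lambda>x. x\<^sup>2 / 4) ` {x. x > 0 \<and> P (x\<^sup>2 / 4)} \<subseteq> {w. w > 0 \<and> P w}"
    by (rule image_subsetI) simp
qed

lemma bessel_zero_set: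
  assumes "\<mu> > -1"
  shows "{x. x > 0 \<and> bessel_J \<mu> x = 0} = {x. x > 0 \<and> bessel_entire \<mu> (x\<^sup>2 / 4) = 0}"
  by (rule Collect_cong) (use bessel_J_eq_0_iff[OF assms] in blast)

lemma bessel_J_infinite_zeros:
  assumes "\<mu> > -1"
  shows "infinite {x. x > 0 \<and> bessel_J \<mu> x = 0}"
  unfolding bessel_zero_set[OF assms]
    bij_betw_finite[OF bij_betw_quarter_square[of "\<lambda>w. bessel_entire \<mu> w = 0"]]
  by (rule bessel_entire_infinite_zeros[OF assms])

lemma bessel_J_zeros_locally_finite:
  assumes "\<mu> > -1"
  shows "finite ({x. x > 0 \<and> bessel_J \<mu> x = 0} \<inter> {..M})"
  unfolding bessel_zero_set[OF assms]
  using bessel_entire_zeros_finite[OF assms] by (rule finite_via_quarter_square)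

lemma bij_betw_bessel_zero:
  assumes "\<mu> > -1"
  shows "bij_betw (bessel_zero \<mu>) {1..} {x. x > 0 \<and> bessel_J \<mu> x = 0}"
  using ascending_seq[OF bessel_J_infinite_zeros[OF assms] bessel_J_zeros_locally_finite[OF assms]]
  by (auto simp: bij_betw_def bessel_zero_def intro: strict_mono_on_imp_inj_on)

lemma bessel_deriv_zero_set:
  assumes "\<nu> > -1"
  shows "{x. x > 0 \<and> deriv (bessel_J \<nu>) x = 0} = {x. x > 0 \<and> bessel_euler \<nu> (x\<^sup>2 / 4) = 0}"
  by (rule Collect_cong) (use deriv_bessel_J_eq_0_iff[OF assms] in blast)

lemma bessel_J_deriv_infinite_zeros:
  assumes "\<nu> > -1"
  shows "infinite {x. x > 0 \<and> deriv (bessel_J \<nu>) x = 0}"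
proof
  let ?D = "{x. x > 0 \<and> deriv (bessel_J \<nu>) x = 0}" and ?Z = "{x. x > 0 \<and> bessel_J \<nu> x = 0}"
  assume fin: "finite ?D"
  define B where "B = Max (insert 0 ?D)"
  have inf: "infinite (?Z - ?Z \<inter> {..M})" for M
    using bessel_J_infinite_zeros[OF assms] bessel_J_zeros_locally_finite[OF assms, of M]
    by (rule Diff_infinite_finite[rotated])
  have ex: "\<exists>x\<in>?Z. M < x" for M
  proof -
    have "?Z - ?Z \<inter> {..M} \<noteq> {}" using inf[of M] by (metis finite.emptyI)
    thus ?thesis by (auto simp: not_le)
  qed
  obtain x where x: "x \<in> ?Z" "B < x" using ex by blast
  obtain y where y: "y \<in> ?Z" "x < y" using ex by blast
  have "\<exists>l t. x < t \<and> t < y \<and> (bessel_J \<nu> has_real_derivative l) (at t) \<and>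
      bessel_J \<nu> y - bessel_J \<nu> x = (y - x) * l"
  proof (rule MVT[OF y(2)])
    show "continuous_on {x..y} (bessel_J \<nu>)"
      using DERIV_isCont[OF DERIV_bessel_J[OF assms]] x(1) by (intro continuous_at_imp_continuous_on) auto
    show "bessel_J \<nu> differentiable (at t)" if "x < t" "t < y" for t
      using DERIV_bessel_J[OF assms, of t] x(1) that by (auto simp: real_differentiable_def)
  qed
  then obtain l t where t: "x < t" "t < y" "(bessel_J \<nu> has_real_derivative l) (at t)"
    "bessel_J \<nu> y - bessel_J \<nu> x = (y - x) * l" by blast
  have "l = 0" using t(4) x(1) y by simp
  hence "t \<in> ?D" using DERIV_imp_deriv[OF t(3)] t(1) x(1) by simp
  hence "t \<le> B" using fin by (simp add: B_def)
  thus False using x(2) t(1) by simp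
qed

lemma bessel_deriv_zero_critical:
  assumes "\<nu> > -1" "\<nu> \<noteq> 0" "n \<ge> 1"
  shows "bessel_deriv_zero \<nu> n > 0" and "bessel_euler \<nu> ((bessel_deriv_zero \<nu> n)\<^sup>2 / 4) = 0"
proof -
  let ?D = "{x. x > 0 \<and> deriv (bessel_J \<nu>) x = 0}"
  have "finite (?D \<inter> {..M})" for M
    unfolding bessel_deriv_zero_set[OF assms(1)]
    using bessel_euler_zeros_finite[OF assms(1,2)] by (rule finite_via_quarter_square)
  from ascending_seq(2)[OF bessel_J_deriv_infinite_zeros[OF assms(1)] this]
  have "bessel_deriv_zero \<nu> n \<in> ?D" using assms(3) unfolding bessel_deriv_zero_def by auto
  thus "bessel_deriv_zero \<nu> n > 0" "bessel_euler \<nu> ((bessel_deriv_zero \<nu> n)\<^sup>2 / 4) = 0"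
    unfolding bessel_deriv_zero_set[OF assms(1)] by auto
qed

theorem mainTheorem15:
  fixes \<nu> :: real and n :: nat
  assumes "\<nu> > -1" and "\<nu> \<noteq> 0" and "n \<ge> 1"
  shows "((\<lambda>k. 1 / ((bessel_deriv_zero \<nu> n)\<^sup>2 - (bessel_zero (\<nu> + 1) k)\<^sup>2)\<^sup>2) has_sum
           (1 / (4 * \<nu>\<^sup>2) - 1 / (4 * (bessel_deriv_zero \<nu> n)\<^sup>2)
             - (\<nu> + 1) / (bessel_deriv_zero \<nu> n) ^ 4)) {1..}"
proof -
  define x where "x = bessel_deriv_zero \<nu> n"
  have x: "x > 0" "bessel_euler \<nu> (x\<^sup>2 / 4) = 0"
    using bessel_deriv_zero_critical[OF assms] by (simp_all add: x_def)
  have "bij_betw (bessel_zero (\<nu> + 1)) {1..} {x. x > 0 \<and> bessel_entire (\<nu> + 1) (x\<^sup>2 / 4) = 0}"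
    using bij_betw_bessel_zero[of "\<nu> + 1"] bessel_zero_set[of "\<nu> + 1"] assms(1) by simp
  note bij = bij_betw_trans[OF this bij_betw_quarter_square[of "\<lambda>w. bessel_entire (\<nu> + 1) w = 0"]]
  have "x\<^sup>2 / 4 > 0" using x(1) by simp
  note sum = bessel_sum_at_critical[OF assms(1,2) this x(2)]
  from has_sum_reindex_bij_betw[OF bij, THEN iffD2, OF sum]
  have "((\<lambda>k. 1 / (x\<^sup>2 / 4 - (bessel_zero (\<nu> + 1) k)\<^sup>2 / 4)\<^sup>2) has_sum
      (4 / \<nu>\<^sup>2 - 1 / (x\<^sup>2 / 4) - (\<nu> + 1) / (x\<^sup>2 / 4)\<^sup>2)) {1..}"
    unfolding o_def .
  from has_sum_cmult_right[OF this, of "1 / 16"]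
  have *: "((\<lambda>k. 1 / 16 * (1 / (x\<^sup>2 / 4 - (bessel_zero (\<nu> + 1) k)\<^sup>2 / 4)\<^sup>2)) has_sum
      1 / 16 * (4 / \<nu>\<^sup>2 - 1 / (x\<^sup>2 / 4) - (\<nu> + 1) / (x\<^sup>2 / 4)\<^sup>2)) {1..}" .
  have summand: "1 / 16 * (1 / (x\<^sup>2 / 4 - y\<^sup>2 / 4)\<^sup>2) = 1 / (x\<^sup>2 - y\<^sup>2)\<^sup>2" for y :: real
    unfolding diff_divide_distrib[symmetric] by (simp add: power_divide)
  have total: "1 / 16 * (4 / \<nu>\<^sup>2 - 1 / (x\<^sup>2 / 4) - (\<nu> + 1) / (x\<^sup>2 / 4)\<^sup>2)
      = 1 / (4 * \<nu>\<^sup>2) - 1 / (4 * x\<^sup>2) - (\<nu> + 1) / x ^ 4"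
  proof -
    have "(\<nu> + 1) / (x\<^sup>2 / 4)\<^sup>2 = 16 * ((\<nu> + 1) / x ^ 4)"
      by (simp add: power_divide flip: power_mult)
    moreover have "1 / 16 * (4 / a - 1 / (b / 4) - 16 * t) = 1 / (4 * a) - 1 / (4 * b) - t"
      for a b t :: real by (simp add: right_diff_distrib)
    ultimately show ?thesis by (simp only:)
  qed
  show ?thesis using *[unfolded summand total] unfolding x_def .
qed

end
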